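(* Let $p$ be an odd prime and $\alpha\geqslant 1$ an integer, and let $X\subseteq\mathbb{Z}_{p^\alpha}\setminus\{0\}$. Then the dihedrant $Dih(p^\alpha,X,X)$ is a (genuine) directed strongly regular graph if and only if $X=\psi_{\gamma}^{-1}(H)$ for some $1\leqslant\gamma\leqslant\alpha$ and some subset $H\subseteq\mathbb{Z}_{p^\gamma}$ satisfying: (i) $H\cup(-H)=\mathbb{Z}_{p^\gamma}\setminus\{0\}$; (ii) $H\cap(-H)=\emptyset$.
   Context: For a positive integer $n$, $D_n=\langle x,a\mid x^n=1,\ a^2=1,\ ax=x^{-1}a\rangle$ is the dihedral group of order $2n$. For $X,Y\subseteq\mathbb{Z}_n$ with $0\notin X$, $Dih(n,X,Y)$ denotes the Cayley digraph $\mathbf{Cay}(D_n,S)$ with $S=\{x^i:i\in X\}\cup\{x^ja:j\in Y\}$: its vertex set is $D_n$ and $g\to h$ is an arc iff $g^{-1}h\in S$. A directed strongly regular graph (DSRG) with parameters $(n,k,\mu,\lambda,t)$ is a digraph on $n$ vertices whose adjacency matrix $A$ satisfies $AJ=JA=kJ$ and $A^2=tI+\lambda A+\mu(J-I-A)$ ($J$ the all-ones matrix); throughout, DSRGs are required to be genuine, i.e. $0<t<k$. For $1\leqslant\gamma\leqslant\alpha$, $\psi_\gamma:\mathbb{Z}_{p^\alpha}\to\mathbb{Z}_{p^\gamma}$ is the reduction-mod-$p^\gamma$ homomorphism (kernel $p^\gamma\mathbb{Z}_{p^\alpha}$), and $\psi_\gamma^{-1}(H)$ is the full preimage of $H$.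 *)

theory Defs
  imports
    "HOL-Algebra.Generated_Groups"
    "HOL-Number_Theory.Residues"
    "Graph_Theory.Digraph"
    "Jordan_Normal_Form.Matrix"
begin

text \<open>
  The dihedral group of order \<open>2n\<close> (for \<open>n > 0\<close>), in normal form: the pair \<open>(i, s)\<close> stands for
  \<open>x\<^sup>i a\<^sup>s\<close>, where \<open>i\<close> is a residue modulo \<open>n\<close> and \<open>s\<close> tells whether the factor \<open>a\<close> occurs.
  The multiplication is forced by \<open>a x\<^sup>j = x\<^bsup>-j\<^esup> a\<close>. The lemmas below show that this is a group
  of order \<open>2n\<close> generated by \<open>x\<close> and \<open>a\<close> subject to the relations of the presentation; as these
  relations bound the order by \<open>2n\<close>, it is the presented group.
\<close>

definition dihedral_group :: "nat \<Rightarrow> (int \<times> bool) monoid" where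
  "dihedral_group n =
     \<lparr>carrier = carrier (residue_ring (int n)) \<times> UNIV,
      monoid.mult = (\<lambda>(i, s) (j, t). ((if s then i - j else i + j) mod int n, s \<noteq> t)),
      one = (0, False)\<rparr>"

definition dih_x :: "nat \<Rightarrow> int \<times> bool" where
  "dih_x n = (1 mod int n, False)"

definition dih_a :: "nat \<Rightarrow> int \<times> bool" where
  "dih_a n = (0, True)"

definition cayley_digraph ::
    "('a, 'b) monoid_scheme \<Rightarrow> 'a set \<Rightarrow> ('a, 'a \<times> 'a) pre_digraph" where
  "cayley_digraph G S =
     \<lparr>verts = carrier G,
      arcs = {(g, h). g \<in> carrier G \<and> h \<in> carrier G \<and> inv\<^bsub>G\<^esub> g \<otimes>\<^bsub>G\<^esub> h \<in> S},
      tail = fst, head = snd\<rparr>"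

definition Dih :: "nat \<Rightarrow> int set \<Rightarrow> int set \<Rightarrow> (int \<times> bool, (int \<times> bool) \<times> (int \<times> bool)) pre_digraph" where
  "Dih n X Y = cayley_digraph (dihedral_group n)
     ({dih_x n [^]\<^bsub>dihedral_group n\<^esub> i | i. i \<in> X} \<union>
      {dih_x n [^]\<^bsub>dihedral_group n\<^esub> j \<otimes>\<^bsub>dihedral_group n\<^esub> dih_a n | j. j \<in> Y})"

text \<open>The rows and columns of the adjacency matrix are indexed by an enumeration \<open>vs\<close> of the vertices.\<close>

definition adjacency_mat :: "('a, 'b) pre_digraph \<Rightarrow> 'a list \<Rightarrow> int mat" where
  "adjacency_mat G vs =
     mat (length vs) (length vs) (\<lambda>(i, j). if vs ! i \<rightarrow>\<^bsub>G\<^esub> vs ! j then 1 else 0)"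

definition all_ones_mat :: "nat \<Rightarrow> int mat" where
  "all_ones_mat n = mat n n (\<lambda>_. 1)"

text \<open>
  The choice of the enumeration is immaterial: another one conjugates the matrices by a permutation
  matrix, which preserves the equations.
\<close>

definition is_dsrg :: "('a, 'b) pre_digraph \<Rightarrow> nat \<Rightarrow> nat \<Rightarrow> nat \<Rightarrow> nat \<Rightarrow> nat \<Rightarrow> bool" where
  "is_dsrg G n k \<mu> lam t \<longleftrightarrow>
     digraph G \<and> card (verts G) = n \<and>
     (\<exists>vs. distinct vs \<and> set vs = verts G \<and>
       (let A = adjacency_mat G vs; J = all_ones_mat n; I = 1\<^sub>m n in
         A * J = int k \<cdot>\<^sub>m J \<and> J * A = int k \<cdot>\<^sub>m J \<and>
         A ^\<^sub>m 2 = int t \<cdot>\<^sub>m I + int lam \<cdot>\<^sub>m A + int \<mu> \<cdot>\<^sub>m (J - I - A)))"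

definition genuine_dsrg :: "('a, 'b) pre_digraph \<Rightarrow> bool" where
  "genuine_dsrg G \<longleftrightarrow> (\<exists>n k \<mu> lam t. is_dsrg G n k \<mu> lam t \<and> 0 < t \<and> t < k)"

text \<open>Reduction modulo \<open>p\<^sup>\<gamma>\<close>, on residues represented by their least non-negative representatives.\<close>

definition psi :: "nat \<Rightarrow> nat \<Rightarrow> int \<Rightarrow> int" where
  "psi p \<gamma> i = i mod int (p ^ \<gamma>)"

definition psi_preimage :: "nat \<Rightarrow> nat \<Rightarrow> nat \<Rightarrow> int set \<Rightarrow> int set" where
  "psi_preimage p \<alpha> \<gamma> H = {i \<in> carrier (residue_ring (int (p ^ \<alpha>))). psi p \<gamma> i \<in> H}"

definition neg_set :: "nat \<Rightarrow> int set \<Rightarrow> int set" where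
  "neg_set m H = {\<ominus>\<^bsub>residue_ring (int m)\<^esub> h | h. h \<in> H}"


lemma dihedral_group_carrier: "carrier (dihedral_group n) = {0..<int n} \<times> UNIV"
  by (auto simp: dihedral_group_def residue_ring_def)

lemma dihedral_group_mult:
  "(i, s) \<otimes>\<^bsub>dihedral_group n\<^esub> (j, t) = ((if s then i - j else i + j) mod int n, s \<noteq> t)"
  by (simp add: dihedral_group_def)

lemma dihedral_group_one: "\<one>\<^bsub>dihedral_group n\<^esub> = (0, False)"
  by (simp add: dihedral_group_def)

lemma group_dihedral_group:
  assumes "n > 0"
  shows "group (dihedral_group n)"
proof (rule groupI)
  fix u assume u: "u \<in> carrier (dihedral_group n)"
  obtain i s where us: "u = (i, s)" by (cases u)
  show "\<exists>v\<in>carrier (dihedral_group n). v \<otimes>\<^bsub>dihedral_group n\<^esub> u = \<one>\<^bsub>dihedral_group n\<^esub>"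
    by (rule bexI[where x = "(if s then i else (- i) mod int n, s)"])
       (use u us assms in \<open>auto simp: dihedral_group_carrier dihedral_group_mult
          dihedral_group_one mod_simps\<close>)
next
  fix u v w :: "int \<times> bool"
  obtain i s j t k r where "u = (i, s)" "v = (j, t)" "w = (k, r)"
    by (metis surj_pair)
  then show "u \<otimes>\<^bsub>dihedral_group n\<^esub> v \<otimes>\<^bsub>dihedral_group n\<^esub> w
      = u \<otimes>\<^bsub>dihedral_group n\<^esub> (v \<otimes>\<^bsub>dihedral_group n\<^esub> w)"
    by (cases s; cases t)
       (simp_all add: dihedral_group_mult mod_simps add_diff_eq diff_add_eq diff_diff_eq2 add.assoc
          flip: diff_diff_eq)
qed (use assms in \<open>auto simp: dihedral_group_carrier dihedral_group_mult dihedral_group_one\<close>)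

lemma order_dihedral_group: "order (dihedral_group n) = 2 * n"
  by (simp add: order_def dihedral_group_def residue_ring_def card_cartesian_product)

lemma dih_x_closed: "n > 0 \<Longrightarrow> dih_x n \<in> carrier (dihedral_group n)"
  by (simp add: dih_x_def dihedral_group_carrier)

lemma dih_a_closed: "n > 0 \<Longrightarrow> dih_a n \<in> carrier (dihedral_group n)"
  by (simp add: dih_a_def dihedral_group_carrier)

lemma dih_x_nat_pow: "dih_x n [^]\<^bsub>dihedral_group n\<^esub> (m :: nat) = (int m mod int n, False)"
proof (induction m)
  case 0
  show ?case by (simp add: dihedral_group_def nat_pow_def)
next
  case (Suc m)
  have "dih_x n [^]\<^bsub>dihedral_group n\<^esub> Suc m
      = dih_x n [^]\<^bsub>dihedral_group n\<^esub> m \<otimes>\<^bsub>dihedral_group n\<^esub> dih_x n"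
    by (simp add: nat_pow_def)
  then show ?case
    using Suc by (simp add: dihedral_group_mult dih_x_def mod_simps add.commute)
qed

lemma dih_x_int_pow:
  assumes "n > 0"
  shows "dih_x n [^]\<^bsub>dihedral_group n\<^esub> (i :: int) = (i mod int n, False)"
proof (cases i rule: int_cases2)
  case (nonneg m)
  then show ?thesis by (simp add: int_pow_int dih_x_nat_pow)
next
  case (nonpos m)
  interpret group "dihedral_group n" by (rule group_dihedral_group[OF assms])
  have "inv\<^bsub>dihedral_group n\<^esub> (dih_x n [^]\<^bsub>dihedral_group n\<^esub> m) = (- int m mod int n, False)"
    by (rule inv_equality)
       (use assms in \<open>simp_all add: dih_x_nat_pow dihedral_group_carrier dihedral_group_mult
          dihedral_group_one mod_add_eq\<close>)
  with nonpos show ?thesis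
    by (simp add: int_pow_neg_int dih_x_closed[OF assms])
qed

lemma dihedral_relations:
  assumes "n > 0"
  shows "dih_x n [^]\<^bsub>dihedral_group n\<^esub> n = \<one>\<^bsub>dihedral_group n\<^esub>"
    and "dih_a n [^]\<^bsub>dihedral_group n\<^esub> (2 :: nat) = \<one>\<^bsub>dihedral_group n\<^esub>"
    and "dih_a n \<otimes>\<^bsub>dihedral_group n\<^esub> dih_x n
         = inv\<^bsub>dihedral_group n\<^esub> dih_x n \<otimes>\<^bsub>dihedral_group n\<^esub> dih_a n"
proof -
  interpret group "dihedral_group n" by (rule group_dihedral_group[OF assms])
  show "dih_x n [^]\<^bsub>dihedral_group n\<^esub> n = \<one>\<^bsub>dihedral_group n\<^esub>"
    by (simp add: dih_x_nat_pow) (simp add: dihedral_group_def)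
  show "dih_a n [^]\<^bsub>dihedral_group n\<^esub> (2 :: nat) = \<one>\<^bsub>dihedral_group n\<^esub>"
    by (simp add: dihedral_group_def dih_a_def nat_pow_def numeral_2_eq_2)
  have "inv\<^bsub>dihedral_group n\<^esub> dih_x n = dih_x n [^]\<^bsub>dihedral_group n\<^esub> (- 1 :: int)"
    using dih_x_closed[OF assms] by (simp add: int_pow_neg)
  also have "\<dots> = ((- 1) mod int n, False)"
    by (rule dih_x_int_pow[OF assms])
  finally show "dih_a n \<otimes>\<^bsub>dihedral_group n\<^esub> dih_x n
      = inv\<^bsub>dihedral_group n\<^esub> dih_x n \<otimes>\<^bsub>dihedral_group n\<^esub> dih_a n"
    by (simp add: dihedral_group_mult dih_a_def dih_x_def mod_simps)
qed

lemma generate_dihedral_group: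
  assumes "n > 0"
  shows "generate (dihedral_group n) {dih_x n, dih_a n} = carrier (dihedral_group n)"
proof -
  interpret group "dihedral_group n" by (rule group_dihedral_group[OF assms])
  have sub: "{dih_x n, dih_a n} \<subseteq> carrier (dihedral_group n)"
    using dih_x_closed[OF assms] dih_a_closed[OF assms] by simp
  have sg: "subgroup (generate (dihedral_group n) {dih_x n, dih_a n}) (dihedral_group n)"
    by (rule generate_is_subgroup[OF sub])
  have "u \<in> generate (dihedral_group n) {dih_x n, dih_a n}"
    if u: "u \<in> carrier (dihedral_group n)" for u
  proof -
    obtain i s where us: "u = (i, s)" by (cases u)
    have i: "0 \<le> i" "i < int n"
      using u us by (auto simp: dihedral_group_def residue_ring_def)
    have x: "dih_x n [^]\<^bsub>dihedral_group n\<^esub> i \<in> generate (dihedral_group n) {dih_x n, dih_a n}"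
      by (rule subgroup_int_pow_closed[OF sg]) (auto intro: generate.incl)
    have "u = (if s then dih_x n [^]\<^bsub>dihedral_group n\<^esub> i \<otimes>\<^bsub>dihedral_group n\<^esub> dih_a n
               else dih_x n [^]\<^bsub>dihedral_group n\<^esub> i)"
      using us i by (simp add: dih_x_int_pow[OF assms]) (simp add: dihedral_group_def dih_a_def)
    then show ?thesis
      using x by (auto intro: generate.eng generate.incl)
  qed
  then show ?thesis
    using generate_incl[OF sub] by blast
qed

end

theory Submission
  imports Defs "HOL-Computational_Algebra.Polynomial"
begin

text \<open>
  Let \<open>x\<close> be the indicator function of \<open>X\<close> on the residues modulo \<open>n = p\<^sup>\<alpha>\<close>, and let
  \<open>Y g = x g + x (- g)\<close>. Counting 2-paths shows that the dihedrant is a DSRG iff \<open>t = \<mu>\<close> and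
  \<open>x * Y = c x + \<mu>\<close> for the cyclic convolution, with \<open>c = \<lambda> - \<mu>\<close>; then \<open>Y * Y = c Y + 2\<mu>\<close>.
  So \<open>Y\<close> is, up to scaling and an additive constant, an idempotent of the rational group ring, and
  hence invariant under multiplication by all units modulo \<open>n\<close>.

  Because \<open>\<Sum>h. (Y (h + g) - Y h)\<^sup>2 = - 2 c Y g\<close>, the zeros of \<open>Y\<close> are its periods, so they are the
  multiples of some \<open>p\<^sup>\<gamma>\<close>. Evaluating the sum for \<open>g = p\<^bsup>\<gamma>-1\<^esup>\<close> and estimating it for all other \<open>g\<close>
  shows that \<open>Y\<close> has a constant value in \<open>{1, 2}\<close> off these multiples. The value 2 would give
  \<open>t = k\<close>, and for the value 1 the equation \<open>x * Y = c x + \<mu>\<close> makes \<open>x\<close> periodic modulo \<open>p\<^sup>\<gamma>\<close>.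
  Conversely, if \<open>x\<close> is periodic modulo \<open>p\<^sup>\<gamma>\<close> and \<open>Y\<close> is the indicator function of the
  non-multiples of \<open>p\<^sup>\<gamma>\<close>, then \<open>x * Y = |X| - p\<^bsup>\<alpha>-\<gamma>\<^esup> x\<close>.
\<close>

subsection \<open>Cyclic convolution\<close>

definition periodic :: "int \<Rightarrow> (int \<Rightarrow> 'a) \<Rightarrow> bool" where
  "periodic n f \<longleftrightarrow> (\<forall>i. f (i mod n) = f i)"

lemma periodicI: "(\<And>i j. [i = j] (mod n) \<Longrightarrow> f i = f j) \<Longrightarrow> periodic n f"
  by (metis periodic_def cong_def mod_mod_trivial)

lemma periodic_cong: "periodic n f \<Longrightarrow> [i = j] (mod n) \<Longrightarrow> f i = f j"
  by (metis cong_def periodic_def)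

lemma periodic_iff_shift: "periodic n f \<longleftrightarrow> (\<forall>i. f (i + n) = f i)"
proof
  assume "periodic n f"
  then show "\<forall>i. f (i + n) = f i"
    by (metis mod_add_self2 periodic_def)
next
  assume shift: "\<forall>i. f (i + n) = f i"
  have multiple: "f (i + k * n) = f i" for i k
  proof (induction k rule: int_induct[where k = 0])
    case (step1 k)
    then show ?case using shift[rule_format, of "i + k * n"] by (simp add: algebra_simps)
  next
    case (step2 k)
    then show ?case using shift[rule_format, of "i + (k - 1) * n"] by (simp add: algebra_simps)
  qed simp
  show "periodic n f"
    unfolding periodic_def using multiple[of "i mod n" "i div n" for i]
    by (metis mod_div_mult_eq)
qed

lemma periodic_reflect: "periodic n f \<Longrightarrow> periodic n (\<lambda>i. f (a - i))"
  by (rule periodicI) (blast intro: periodic_cong cong_diff cong_refl)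

lemma periodic_eq_iff:
  assumes "n > 0" and "periodic n f" and "periodic n g"
  shows "(\<forall>i\<in>{0..<n}. f i = g i) \<longleftrightarrow> (\<forall>i. f i = g i)"
proof
  assume eq: "\<forall>i\<in>{0..<n}. f i = g i"
  show "\<forall>i. f i = g i"
  proof
    fix i
    have "f (i mod n) = g (i mod n)" using eq assms(1) by simp
    then show "f i = g i" using assms(2,3) by (simp add: periodic_def)
  qed
qed simp

lemma periodic_mult: "periodic n f \<Longrightarrow> periodic n g \<Longrightarrow> periodic n (\<lambda>i. f i * g i)"
  by (simp add: periodic_def)

lemma sum_periodic_shift:
  fixes f :: "int \<Rightarrow> 'a :: comm_monoid_add"
  assumes "n > 0" and "periodic n f"
  shows "(\<Sum>i\<in>{0..<n}. f (i + a)) = (\<Sum>i\<in>{0..<n}. f i)"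
  by (rule sum.reindex_bij_witness[where i = "\<lambda>i. (i - a) mod n" and j = "\<lambda>i. (i + a) mod n"])
     (use assms in \<open>auto simp: mod_simps periodic_def\<close>)

lemma sum_periodic_reflect:
  fixes f :: "int \<Rightarrow> 'a :: comm_monoid_add"
  assumes "n > 0" and "periodic n f"
  shows "(\<Sum>i\<in>{0..<n}. f (a - i)) = (\<Sum>i\<in>{0..<n}. f i)"
  by (rule sum.reindex_bij_witness[where i = "\<lambda>i. (a - i) mod n" and j = "\<lambda>i. (a - i) mod n"])
     (use assms in \<open>auto simp: mod_simps periodic_def\<close>)

definition cyclic_conv :: "int \<Rightarrow> (int \<Rightarrow> 'a :: comm_ring_1) \<Rightarrow> (int \<Rightarrow> 'a) \<Rightarrow> int \<Rightarrow> 'a" where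
  "cyclic_conv n f g k = (\<Sum>h\<in>{0..<n}. f h * g (k - h))"

lemma periodic_cyclic_conv:
  assumes "periodic n g"
  shows "periodic n (cyclic_conv n f g)"
proof (rule periodicI)
  fix i j assume "[i = j] (mod n)"
  then have "g (i - h) = g (j - h)" for h
    by (intro periodic_cong[OF assms] cong_diff cong_refl)
  then show "cyclic_conv n f g i = cyclic_conv n f g j"
    by (simp add: cyclic_conv_def)
qed

lemma cyclic_conv_add_left:
  "cyclic_conv n (\<lambda>i. f i + f' i) g k = cyclic_conv n f g k + cyclic_conv n f' g k"
  by (simp add: cyclic_conv_def distrib_right sum.distrib)

lemma cyclic_conv_delta_left:
  assumes "n > 0"
  shows "cyclic_conv n (\<lambda>i. of_bool (n dvd i) * a) g k = a * g k"
proof -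
  have "cyclic_conv n (\<lambda>i. of_bool (n dvd i) * a) g k
      = (\<Sum>h\<in>{0..<n}. if h = 0 then a * g k else 0)"
    unfolding cyclic_conv_def by (intro sum.cong) (auto dest: zdvd_imp_le)
  then show ?thesis using assms by simp
qed

lemma cyclic_conv_shift_left:
  assumes "n > 0" and "periodic n f" and "periodic n g"
  shows "cyclic_conv n (\<lambda>i. f (i - a)) g k = cyclic_conv n f g (k - a)"
proof -
  have "periodic n (\<lambda>h. f h * g (k - a - h))"
    by (intro periodic_mult periodic_reflect assms(2,3))
  from sum_periodic_shift[OF assms(1) this, of "- a"] show ?thesis
    by (simp add: cyclic_conv_def)
qed

lemma cyclic_conv_reflect:
  assumes "n > 0" and "periodic n f" and "periodic n g"
  shows "cyclic_conv n (\<lambda>i. f (- i)) (\<lambda>i. g (- i)) k = cyclic_conv n f g (- k)"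
proof -
  have "periodic n (\<lambda>h. f h * g (- k - h))"
    by (intro periodic_mult periodic_reflect assms(2,3))
  from sum_periodic_reflect[OF assms(1) this, of 0] show ?thesis
    by (simp add: cyclic_conv_def algebra_simps)
qed

lemma sum_cyclic_conv:
  assumes "n > 0" and "periodic n g"
  shows "(\<Sum>k\<in>{0..<n}. cyclic_conv n f g k) = (\<Sum>i\<in>{0..<n}. f i) * (\<Sum>i\<in>{0..<n}. g i)"
proof -
  have "(\<Sum>k\<in>{0..<n}. cyclic_conv n f g k) = (\<Sum>h\<in>{0..<n}. f h * (\<Sum>k\<in>{0..<n}. g (k + - h)))"
    unfolding cyclic_conv_def by (subst sum.swap) (simp add: sum_distrib_left)
  then show ?thesis
    unfolding sum_periodic_shift[OF assms] by (simp add: sum_distrib_right)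
qed

lemma cyclic_conv_affine:
  assumes "n > 0" and "periodic n f"
  shows "cyclic_conv n (\<lambda>i. a * f i + b) (\<lambda>i. a * f i + b) k
    = a\<^sup>2 * cyclic_conv n f f k + 2 * a * b * (\<Sum>i\<in>{0..<n}. f i) + of_int n * b\<^sup>2"
proof -
  have "cyclic_conv n (\<lambda>i. a * f i + b) (\<lambda>i. a * f i + b) k
      = (\<Sum>h\<in>{0..<n}. a\<^sup>2 * (f h * f (k - h)) + a * b * f h + a * b * f (k - h) + b\<^sup>2)"
    by (simp add: cyclic_conv_def algebra_simps power2_eq_square)
  also have "\<dots> = a\<^sup>2 * cyclic_conv n f f k + a * b * (\<Sum>i\<in>{0..<n}. f i)
      + a * b * (\<Sum>i\<in>{0..<n}. f i) + of_int n * b\<^sup>2"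
    unfolding sum.distrib sum_distrib_left[symmetric] sum_periodic_reflect[OF assms, of k]
    using assms(1) by (simp add: cyclic_conv_def)
  finally show ?thesis by (simp add: algebra_simps)
qed

lemma sum_translate_diff_square:
  assumes "n > 0" and "periodic n f" and even: "\<And>i. f (- i) = f i"
  shows "(\<Sum>h\<in>{0..<n}. (f (h + g) - f h)\<^sup>2) = 2 * (cyclic_conv n f f 0 - cyclic_conv n f f g)"
proof -
  have square: "(\<Sum>h\<in>{0..<n}. (f h)\<^sup>2) = cyclic_conv n f f 0"
    by (simp add: cyclic_conv_def even power2_eq_square)
  have "periodic n (\<lambda>h. (f h)\<^sup>2)"
    using assms(2) by (simp add: periodic_def)
  from sum_periodic_shift[OF assms(1) this]
  have shifted: "(\<Sum>h\<in>{0..<n}. (f (h + g))\<^sup>2) = cyclic_conv n f f 0"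
    by (simp add: square)
  have "f (- g - h) = f (h + g)" for h using even[of "h + g"] by (simp add: algebra_simps)
  then have mixed: "(\<Sum>h\<in>{0..<n}. f h * f (h + g)) = cyclic_conv n f f g"
    using cyclic_conv_reflect[OF assms(1,2,2), of g] by (simp add: cyclic_conv_def even)
  have "(\<Sum>h\<in>{0..<n}. (f (h + g) - f h)\<^sup>2)
      = (\<Sum>h\<in>{0..<n}. (f (h + g))\<^sup>2 + (f h)\<^sup>2 - 2 * (f h * f (h + g)))"
    by (simp add: power2_diff mult_ac)
  then show ?thesis
    unfolding sum.distrib sum_subtractf sum_distrib_left[symmetric] square shifted mixed by simp
qed

definition symmetrization :: "(int \<Rightarrow> 'a :: comm_ring_1) \<Rightarrow> int \<Rightarrow> 'a" where
  "symmetrization f g = f g + f (- g)"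

lemma periodic_symmetrization: "periodic n f \<Longrightarrow> periodic n (symmetrization f)"
  using periodic_reflect[of n f 0] by (simp add: periodic_def symmetrization_def)

lemma sum_symmetrization:
  assumes "n > 0" and "periodic n f"
  shows "(\<Sum>h\<in>{0..<n}. symmetrization f h) = 2 * (\<Sum>h\<in>{0..<n}. f h)"
  using sum_periodic_reflect[OF assms, of 0] by (simp add: symmetrization_def sum.distrib)

lemma cyclic_conv_symmetrization:
  assumes n_pos: "n > 0" and periodic: "periodic n f"
    and conv: "\<And>g. cyclic_conv n f (symmetrization f) g = c * f g + m"
  shows "cyclic_conv n (symmetrization f) (symmetrization f) g = c * symmetrization f g + 2 * m"
proof -
  have even: "symmetrization f (- i) = symmetrization f i" for i
    by (simp add: symmetrization_def)
  have "cyclic_conv n (\<lambda>i. f (- i)) (symmetrization f) g = cyclic_conv n f (symmetrization f) (- g)"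
    using cyclic_conv_reflect[OF n_pos periodic periodic_symmetrization[OF periodic], of g]
    by (simp add: even)
  then have "cyclic_conv n (\<lambda>i. f i + f (- i)) (symmetrization f) g = c * (f g + f (- g)) + 2 * m"
    by (simp add: cyclic_conv_add_left conv distrib_left)
  then show ?thesis by (simp add: symmetrization_def[abs_def])
qed

subsection \<open>The group ring of a cyclic group\<close>

text \<open>
  The image of \<open>P\<close> in \<open>R[x] / (x\<^sup>n - 1)\<close>, which is the group ring of the residues modulo \<open>n\<close>, as a
  periodic function of the exponent.
\<close>

definition cyclic_coeff :: "int \<Rightarrow> 'a :: comm_ring_1 poly \<Rightarrow> int \<Rightarrow> 'a" where
  "cyclic_coeff n P k = (\<Sum>i\<le>degree P. of_bool [int i = k] (mod n) * coeff P i)"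

lemma periodic_cyclic_coeff: "periodic n (cyclic_coeff n P)"
  unfolding periodic_def cyclic_coeff_def cong_def mod_mod_trivial by (intro allI refl)

lemma cyclic_coeff_0 [simp]: "cyclic_coeff n 0 k = 0"
  by (simp add: cyclic_coeff_def)

lemma cyclic_coeff_pCons:
  "cyclic_coeff n (pCons a P) k = of_bool (n dvd k) * a + cyclic_coeff n P (k - 1)"
proof -
  have zero: "[int 0 = k] (mod n) \<longleftrightarrow> n dvd k"
    by (simp add: cong_iff_dvd_diff)
  have suc: "[int (Suc i) = k] (mod n) \<longleftrightarrow> [int i = k - 1] (mod n)" for i
    by (simp add: cong_iff_dvd_diff algebra_simps)
  show ?thesis
  proof (cases "P = 0")
    case True
    then show ?thesis by (cases "a = 0") (simp_all add: cyclic_coeff_def zero[simplified])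
  next
    case False
    then have "cyclic_coeff n (pCons a P) k
        = (\<Sum>i\<le>Suc (degree P). of_bool [int i = k] (mod n) * coeff (pCons a P) i)"
      by (simp add: cyclic_coeff_def del: sum.atMost_Suc)
    then show ?thesis
      unfolding sum.atMost_Suc_shift suc zero cyclic_coeff_def by simp
  qed
qed

lemma cyclic_coeff_smult [simp]: "cyclic_coeff n (smult a P) k = a * cyclic_coeff n P k"
  by (induction P arbitrary: k) (simp_all add: cyclic_coeff_pCons distrib_left)

lemma cyclic_coeff_add [simp]:
  "cyclic_coeff n (P + Q) k = cyclic_coeff n P k + cyclic_coeff n Q k"
proof (induction P arbitrary: Q k)
  case (pCons a P)
  then show ?case by (cases Q) (simp add: cyclic_coeff_pCons)
qed simp

lemma cyclic_coeff_diff [simp]: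
  "cyclic_coeff n (P - Q) k = cyclic_coeff n P k - cyclic_coeff n Q k"
  using cyclic_coeff_add[of n "P - Q" Q k] by simp

lemma cyclic_coeff_sum:
  "cyclic_coeff n (\<Sum>i\<in>I. P i) k = (\<Sum>i\<in>I. cyclic_coeff n (P i) k)"
  by (induction I rule: infinite_finite_induct) simp_all

lemma cyclic_coeff_monom:
  "cyclic_coeff n (monom a m) k = of_bool [int m = k] (mod n) * a"
  by (cases "a = 0") (auto simp: cyclic_coeff_def degree_monom_eq if_distrib cong: if_cong)

lemma cyclic_coeff_mult:
  assumes "n > 0"
  shows "cyclic_coeff n (P * Q) = cyclic_conv n (cyclic_coeff n P) (cyclic_coeff n Q)"
proof (induction P)
  case 0
  then show ?case by (simp add: fun_eq_iff cyclic_conv_def)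
next
  case (pCons a P)
  show ?case
  proof
    fix k
    have "cyclic_conv n (cyclic_coeff n (pCons a P)) (cyclic_coeff n Q) k
        = a * cyclic_coeff n Q k + cyclic_conv n (cyclic_coeff n P) (cyclic_coeff n Q) (k - 1)"
      unfolding cyclic_coeff_pCons cyclic_conv_add_left cyclic_conv_delta_left[OF assms]
      by (simp add: cyclic_conv_shift_left[OF assms] periodic_cyclic_coeff)
    also have "\<dots> = cyclic_coeff n (smult a Q + pCons 0 (P * Q)) k"
      by (simp add: cyclic_coeff_pCons pCons.IH)
    finally show "cyclic_coeff n (pCons a P * Q) k
        = cyclic_conv n (cyclic_coeff n (pCons a P)) (cyclic_coeff n Q) k"
      by simp
  qed
qed

lemma cyclic_coeff_mult_cong:
  assumes "n > 0" and "cyclic_coeff n A = cyclic_coeff n B"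
  shows "cyclic_coeff n (A * P) = cyclic_coeff n (B * P)"
  using assms by (simp add: cyclic_coeff_mult)

lemma cyclic_coeff_power_cong:
  assumes "n > 0" and "cyclic_coeff n A = cyclic_coeff n B"
  shows "cyclic_coeff n (A ^ m) = cyclic_coeff n (B ^ m)"
  by (induction m) (simp_all add: cyclic_coeff_mult assms)

lemma cyclic_coeff_surj:
  assumes "n > 0" and "periodic n f"
  obtains P where "cyclic_coeff n P = f"
proof
  show "cyclic_coeff n (\<Sum>i\<in>{0..<n}. monom (f i) (nat i)) = f"
  proof
    fix k
    have "cyclic_coeff n (\<Sum>i\<in>{0..<n}. monom (f i) (nat i)) k
        = (\<Sum>i\<in>{0..<n}. of_bool (i = k mod n) * f i)"
      unfolding cyclic_coeff_sum cyclic_coeff_monom by (intro sum.cong) (auto simp: cong_def)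
    also have "\<dots> = f k"
      using assms by (simp add: periodic_def)
    finally show "cyclic_coeff n (\<Sum>i\<in>{0..<n}. monom (f i) (nat i)) k = f k" .
  qed
qed

lemma cyclic_coeff_monom_mult:
  "cyclic_coeff n (monom 1 m * P) k = cyclic_coeff n P (k - int m)"
proof (induction m arbitrary: k)
  case (Suc m)
  then show ?case
    using cyclic_coeff_pCons[of n 0 "monom 1 m * P" k] by (simp add: monom_Suc algebra_simps)
qed simp

lemma cyclic_coeff_pcompose_monom:
  assumes "coprime (int q) n"
  shows "cyclic_coeff n (P \<circ>\<^sub>p monom 1 q) (int q * k) = cyclic_coeff n P k"
proof (induction P arbitrary: k)
  case (pCons a P)
  have "n dvd int q * k \<longleftrightarrow> n dvd k"
    using assms by (simp add: coprime_dvd_mult_right_iff coprime_commute)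
  moreover have "int q * k - int q = int q * (k - 1)"
    by (simp add: right_diff_distrib)
  ultimately show ?case
    by (simp add: pcompose_pCons cyclic_coeff_pCons cyclic_coeff_monom_mult pCons.IH)
qed simp

lemma cyclic_coeff_pcompose_monom_eqI:
  assumes "coprime (int q) n" and "cyclic_coeff n A = cyclic_coeff n B"
  shows "cyclic_coeff n (A \<circ>\<^sub>p monom 1 q) = cyclic_coeff n (B \<circ>\<^sub>p monom 1 q)"
proof
  fix g
  obtain i where "[int q * i = 1] (mod n)"
    using cong_solve_coprime_int[OF assms(1)] by blast
  then have "[int q * (i * g) = g] (mod n)"
    using cong_scalar_right[of "int q * i" 1 n g] by (simp add: mult.assoc)
  then show "cyclic_coeff n (A \<circ>\<^sub>p monom 1 q) g = cyclic_coeff n (B \<circ>\<^sub>p monom 1 q) g"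
    using periodic_cong[OF periodic_cyclic_coeff] cyclic_coeff_pcompose_monom[OF assms(1)] assms(2)
    by metis
qed

subsection \<open>Multipliers of idempotents\<close>

lemma prime_dvd_power_add_minus:
  fixes a b :: "'a :: comm_ring_1"
  assumes "prime q"
  shows "of_nat q dvd (a + b) ^ q - (a ^ q + b ^ q)"
proof -
  define f where "f k = of_nat (q choose k) * a ^ k * b ^ (q - k)" for k
  have "q > 1" using assms by (rule prime_gt_1_nat)
  then have ends: "{..q} = insert 0 (insert q {1..<q})" by auto
  have "(a + b) ^ q = (\<Sum>k\<le>q. f k)"
    by (simp add: binomial_ring f_def)
  also have "\<dots> = b ^ q + (a ^ q + (\<Sum>k\<in>{1..<q}. f k))"
    unfolding ends using \<open>q > 1\<close> by (simp add: f_def)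
  finally have middle: "(a + b) ^ q - (a ^ q + b ^ q) = (\<Sum>k\<in>{1..<q}. f k)" by simp
  have "of_nat q dvd f k" if "k \<in> {1..<q}" for k
  proof -
    have "q dvd (q choose k)" using that assms by (intro dvd_choose_prime) auto
    then have "(of_nat q :: 'a) dvd of_nat (q choose k)" by auto
    then show ?thesis unfolding f_def by simp
  qed
  then show ?thesis unfolding middle by (rule dvd_sum)
qed

lemma int_fermat_theorem:
  fixes a :: int
  assumes "prime q" and "\<not> int q dvd a"
  shows "[a ^ (q - 1) = 1] (mod int q)"
proof -
  have "coprime a (int q)"
    using assms prime_imp_coprime[of "int q" a] by (simp add: coprime_commute)
  moreover have "residues (int q)"
    using prime_gt_1_nat[OF assms(1)] by (simp add: residues_def)
  ultimately show ?thesis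
    using residues.euler_theorem[of "int q" a] assms(1) by (simp add: totient_prime)
qed

lemma prime_dvd_int_power_minus:
  fixes a :: int
  assumes "prime q"
  shows "int q dvd a ^ q - a"
proof (cases "int q dvd a")
  case True
  then show ?thesis
    using prime_gt_0_nat[OF assms] by (meson dvd_diff dvd_power dvd_trans)
next
  case False
  then have "int q dvd a ^ (q - 1) - 1"
    using int_fermat_theorem[OF assms] by (simp add: cong_iff_dvd_diff)
  then have "int q dvd a * (a ^ (q - 1) - 1)" by simp
  then show ?thesis
    using prime_gt_0_nat[OF assms] by (simp add: right_diff_distrib flip: power_Suc)
qed

lemma prime_dvd_poly_power_minus_pcompose:
  fixes P :: "int poly"
  assumes "prime q"
  shows "of_nat q dvd P ^ q - P \<circ>\<^sub>p monom 1 q"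
proof (induction P)
  case 0
  then show ?case using assms by (simp add: prime_gt_0_nat zero_power)
next
  case (pCons a P)
  have "pCons a P = [:a:] + monom 1 1 * P"
    by (simp add: monom_Suc)
  then have "of_nat q dvd (pCons a P) ^ q - ([:a:] ^ q + (monom 1 1 * P) ^ q)"
    using prime_dvd_power_add_minus[OF assms, of "[:a:]"] by simp
  moreover have "of_nat q dvd [:a:] ^ q - [:a:]"
  proof -
    have "[:int q:] dvd [:a ^ q - a:]"
      using prime_dvd_int_power_minus[OF assms] by simp
    then show ?thesis by (simp add: poly_const_pow of_nat_poly)
  qed
  moreover have "of_nat q dvd (monom 1 1 * P) ^ q - monom 1 q * (P \<circ>\<^sub>p monom 1 q)"
  proof -
    have "(monom 1 1 * P) ^ q - monom 1 q * (P \<circ>\<^sub>p monom 1 q)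
        = monom 1 q * (P ^ q - P \<circ>\<^sub>p monom 1 q)"
      by (simp add: power_mult_distrib monom_power right_diff_distrib)
    then show ?thesis using pCons.IH by simp
  qed
  ultimately have "of_nat q dvd (pCons a P ^ q - ([:a:] ^ q + (monom 1 1 * P) ^ q))
      + (([:a:] ^ q - [:a:]) + ((monom 1 1 * P) ^ q - monom 1 q * (P \<circ>\<^sub>p monom 1 q)))"
    by (intro dvd_add)
  also have "\<dots> = pCons a P ^ q - pCons a P \<circ>\<^sub>p monom 1 q"
    unfolding pcompose_pCons by simp
  finally show ?case .
qed

definition scaled_idempotent :: "int \<Rightarrow> 'a :: comm_ring_1 \<Rightarrow> 'a poly \<Rightarrow> bool" where
  "scaled_idempotent n c P \<longleftrightarrow> cyclic_coeff n (P\<^sup>2) = cyclic_coeff n (smult c P)"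

lemma scaled_idempotent_power:
  assumes "n > 0" and "scaled_idempotent n c P"
  shows "cyclic_coeff n (P ^ Suc m) = cyclic_coeff n (smult (c ^ m) P)"
proof (induction m)
  case (Suc m)
  have "cyclic_coeff n (P ^ Suc (Suc m)) = cyclic_coeff n (smult (c ^ m) P * P)"
    using cyclic_coeff_mult_cong[OF assms(1) Suc, of P] by (simp add: mult_ac)
  also have "\<dots> = (\<lambda>k. c ^ m * cyclic_coeff n (P\<^sup>2) k)"
    by (simp add: fun_eq_iff power2_eq_square)
  also have "\<dots> = cyclic_coeff n (smult (c ^ Suc m) P)"
    using assms(2) by (simp add: scaled_idempotent_def fun_eq_iff mult_ac)
  finally show ?case .
qed simp

lemma scaled_idempotent_pcompose_monom:
  assumes "coprime (int q) n" and "scaled_idempotent n c P"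
  shows "scaled_idempotent n c (P \<circ>\<^sub>p monom 1 q)"
  using cyclic_coeff_pcompose_monom_eqI[OF assms(1), of "P\<^sup>2" "smult c P"] assms(2)
  by (simp add: scaled_idempotent_def power2_eq_square pcompose_mult pcompose_smult)

lemma scaled_idempotent_diff_cube:
  assumes "n > 0" and "scaled_idempotent n c P" and "scaled_idempotent n c Q"
  shows "cyclic_coeff n ((P - Q) ^ 3) k = c\<^sup>2 * cyclic_coeff n (P - Q) k"
proof -
  note squares = assms(2,3)[unfolded scaled_idempotent_def]
  note square_mult = squares[THEN cyclic_coeff_mult_cong[OF assms(1)], THEN fun_cong]
  have "(P - Q) ^ 3 = P\<^sup>2 * P - Q\<^sup>2 * Q + 3 * (Q\<^sup>2 * P - P\<^sup>2 * Q)"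
    by (simp add: power3_eq_cube power2_eq_square algebra_simps)
  also have "3 * (Q\<^sup>2 * P - P\<^sup>2 * Q) = smult 3 (Q\<^sup>2 * P - P\<^sup>2 * Q)"
    by (simp add: numeral_poly)
  finally have "cyclic_coeff n ((P - Q) ^ 3) k
      = c * cyclic_coeff n (P * P) k - c * cyclic_coeff n (Q * Q) k"
    by (simp add: square_mult mult.commute[of Q P])
  also have "\<dots> = c * (c * cyclic_coeff n P k) - c * (c * cyclic_coeff n Q k)"
    by (simp add: squares flip: power2_eq_square)
  finally show ?thesis by (simp add: power2_eq_square algebra_simps)
qed

lemma scaled_idempotent_diff_odd_power:
  assumes "n > 0" and "scaled_idempotent n c P" and "scaled_idempotent n c Q"
  shows "cyclic_coeff n ((P - Q) ^ (2 * m + 1)) = cyclic_coeff n (smult (c ^ (2 * m)) (P - Q))"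
proof (induction m)
  case (Suc m)
  have "cyclic_coeff n ((P - Q) ^ (2 * Suc m + 1))
      = cyclic_coeff n ((P - Q) ^ (2 * m + 1) * (P - Q)\<^sup>2)"
    by (simp add: power2_eq_square mult_ac)
  also have "\<dots> = cyclic_coeff n (smult (c ^ (2 * m)) (P - Q) * (P - Q)\<^sup>2)"
    by (rule cyclic_coeff_mult_cong[OF assms(1) Suc])
  also have "\<dots> = (\<lambda>k. c ^ (2 * m) * cyclic_coeff n ((P - Q) ^ 3) k)"
    by (simp add: fun_eq_iff power3_eq_cube power2_eq_square mult.assoc)
  also have "\<dots> = cyclic_coeff n (smult (c ^ (2 * Suc m)) (P - Q))"
    by (simp add: fun_eq_iff scaled_idempotent_diff_cube[OF assms] power2_eq_square mult_ac)
  finally show ?case .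
qed simp

text \<open>Every power of \<open>q\<close> divides \<open>P - Q\<close>, as \<open>c\<^bsup>2m\<^esup> (P - Q) = (P - Q)\<^bsup>2m+1\<^esup> = q\<^bsup>2m+1\<^esup> B\<^bsup>2m+1\<^esup>\<close>.\<close>

lemma scaled_idempotents_congruent_imp_eq:
  fixes c :: int
  assumes "n > 0" and idempotents: "scaled_idempotent n c P" "scaled_idempotent n c Q"
    and prime_q: "prime q" and q_not_dvd: "\<not> int q dvd c"
    and congruent: "cyclic_coeff n (P - Q) = cyclic_coeff n (smult (int q) B)"
  shows "cyclic_coeff n P = cyclic_coeff n Q"
proof
  fix g
  have powers_dvd: "int q ^ (2 * m + 1) dvd cyclic_coeff n (P - Q) g" for m
  proof -
    have "c ^ (2 * m) * cyclic_coeff n (P - Q) g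
        = int q ^ (2 * m + 1) * cyclic_coeff n (B ^ (2 * m + 1)) g"
      using fun_cong[OF scaled_idempotent_diff_odd_power[OF assms(1) idempotents], of m g]
      unfolding cyclic_coeff_power_cong[OF assms(1) congruent] by (simp add: smult_power mult_ac)
    then have "int q ^ (2 * m + 1) dvd c ^ (2 * m) * cyclic_coeff n (P - Q) g" by simp
    moreover have "coprime (int q ^ (2 * m + 1)) (c ^ (2 * m))"
      using prime_imp_coprime[of "int q" c] prime_q q_not_dvd by simp
    ultimately show ?thesis by (simp add: coprime_dvd_mult_right_iff)
  qed
  have "cyclic_coeff n (P - Q) g = 0"
  proof (rule ccontr)
    assume nonzero: "cyclic_coeff n (P - Q) g \<noteq> 0"
    have "\<not> is_unit (int q)" using prime_gt_1_nat[OF prime_q] by simp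
    then have "2 * m + 1 \<le> multiplicity (int q) (cyclic_coeff n (P - Q) g)" for m
      using power_dvd_iff_le_multiplicity[OF nonzero] powers_dvd by blast
    from this[of "multiplicity (int q) (cyclic_coeff n (P - Q) g)"] show False by simp
  qed
  then show "cyclic_coeff n P g = cyclic_coeff n Q g" by simp
qed

lemma scaled_idempotent_frobenius:
  fixes P :: "int poly"
  assumes "n > 0" and idempotent: "scaled_idempotent n c P"
    and prime_q: "prime q" and q_not_dvd: "\<not> int q dvd c"
  obtains B where "cyclic_coeff n (P - P \<circ>\<^sub>p monom 1 q) = cyclic_coeff n (smult (int q) B)"
proof -
  define Q where "Q = P \<circ>\<^sub>p monom 1 q"
  obtain A where frobenius: "P ^ q - Q = of_nat q * A"
    using prime_dvd_poly_power_minus_pcompose[OF prime_q, of P] unfolding Q_def by (elim dvdE)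
  obtain b where fermat: "c ^ (q - 1) - 1 = int q * b"
    using int_fermat_theorem[OF prime_q q_not_dvd] by (auto simp: cong_iff_dvd_diff)
  have "cyclic_coeff n (P - Q) k = cyclic_coeff n (smult (int q) (A - smult b P)) k" for k
  proof -
    have "cyclic_coeff n (P ^ q) k = c ^ (q - 1) * cyclic_coeff n P k"
      using scaled_idempotent_power[OF assms(1) idempotent, of "q - 1"] prime_gt_0_nat[OF prime_q]
      by simp
    also have "c ^ (q - 1) = 1 + int q * b" using fermat by simp
    finally have "cyclic_coeff n (P ^ q - Q) k
        = cyclic_coeff n (P - Q) k + int q * b * cyclic_coeff n P k"
      by (simp add: algebra_simps)
    moreover have "cyclic_coeff n (P ^ q - Q) k = int q * cyclic_coeff n A k"
      unfolding frobenius by (simp add: of_nat_poly)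
    ultimately show ?thesis by (simp add: algebra_simps)
  qed
  then show thesis
    using that unfolding Q_def by blast
qed

lemma prime_multiplier:
  fixes F :: "int \<Rightarrow> int"
  assumes n_pos: "n > 0" and periodic: "periodic n F"
    and conv: "\<And>g. cyclic_conv n F F g = c * F g"
    and prime_q: "prime q" and q_not_dvd: "\<not> int q dvd c" and q_coprime: "coprime (int q) n"
  shows "F (int q * g) = F g"
proof -
  obtain P where coeff_P: "cyclic_coeff n P = F"
    using cyclic_coeff_surj[OF n_pos periodic] by blast
  have idempotent: "scaled_idempotent n c P"
    by (simp add: scaled_idempotent_def fun_eq_iff power2_eq_square cyclic_coeff_mult[OF n_pos]
        coeff_P conv)
  obtain B where
    "cyclic_coeff n (P - P \<circ>\<^sub>p monom 1 q) = cyclic_coeff n (smult (int q) B)"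
    using scaled_idempotent_frobenius[OF n_pos idempotent prime_q q_not_dvd] .
  then have "F = cyclic_coeff n (P \<circ>\<^sub>p monom 1 q)"
    unfolding coeff_P[symmetric]
    by (intro scaled_idempotents_congruent_imp_eq[OF n_pos idempotent _ prime_q q_not_dvd]
        scaled_idempotent_pcompose_monom[OF q_coprime idempotent])
  then show ?thesis
    using cyclic_coeff_pcompose_monom[OF q_coprime, of P g] by (simp add: coeff_P)
qed

lemma coprime_add_mult:
  fixes a b k :: int
  shows "coprime a (b + a * k) \<longleftrightarrow> coprime a b"
  using gcd_add_mult[of a k b] by (metis add.commute coprime_iff_gcd_eq_1 mult.commute)

lemma exists_coprime_shift:
  fixes u n c :: int
  assumes "coprime u n" and "c \<noteq> 0"
  shows "\<exists>k. coprime (u + n * k) c"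
  using assms(2)
proof (induction c rule: prime_divisors_induct)
  case (unit c)
  have "coprime (u + n * 0) c" by (rule is_unit_right_imp_coprime[OF unit(1)])
  then show ?case ..
next
  case (factor r c)
  then obtain k where shift_coprime: "coprime (u + n * k) c" by auto
  define v where "v = u + n * k"
  show ?case
  proof (cases "r dvd v")
    case False
    then have "coprime r v" by (rule prime_imp_coprime[OF factor(1)])
    then have "coprime v (r * c)" using shift_coprime by (simp add: v_def coprime_commute)
    then show ?thesis unfolding v_def ..
  next
    case True
    have "coprime n v"
      using assms(1) by (simp add: v_def coprime_add_mult coprime_commute)
    then have "\<not> r dvd n * c"
      using True shift_coprime factor(1) unfolding v_def
      by (metis coprime_common_divisor not_prime_unit prime_dvd_mult_iff)
    then have "\<not> r dvd v + n * c"
      using True by (simp add: dvd_add_right_iff)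
    then have "coprime r (v + n * c)"
      by (rule prime_imp_coprime[OF factor(1)])
    moreover have "coprime c (v + n * c)"
      using shift_coprime coprime_add_mult[of c v n]
      by (simp add: v_def coprime_commute mult.commute)
    ultimately have "coprime (u + n * (k + c)) (r * c)"
      by (simp add: v_def distrib_left add.assoc coprime_commute)
    then show ?thesis ..
  qed
qed simp

lemma unit_multiplier:
  fixes F :: "int \<Rightarrow> int"
  assumes n_pos: "n > 0" and periodic: "periodic n F" and conv: "\<And>g. cyclic_conv n F F g = c * F g"
    and c_nonzero: "c \<noteq> 0" and u_coprime: "coprime u n"
  shows "F (u * g) = F g"
proof -
  have coprime_multiplier: "F (int v * g) = F g" if "coprime (int v) (n * c)" for v g
    using that
  proof (induction v arbitrary: g rule: prime_divisors_induct)
    case zero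
    then have "n = 1" using n_pos by simp
    then show ?case using periodic_cong[OF periodic] by simp
  next
    case (factor q v)
    then have "coprime (int q) n" and "coprime (int q) c" by simp_all
    moreover from this(2) have "\<not> int q dvd c"
      using factor(1) prime_gt_1_nat by (auto simp: coprime_absorb_left)
    ultimately have "F (int q * (int v * g)) = F (int v * g)"
      using prime_multiplier[OF n_pos periodic conv factor(1)] by blast
    then show ?case using factor by (simp add: mult.assoc)
  qed simp
  obtain k where shift_coprime: "coprime (u + n * k) (n * c)"
    using exists_coprime_shift[OF u_coprime, of "n * c"] n_pos c_nonzero by auto
  define v where "v = nat ((u + n * k) mod (n * \<bar>c\<bar>))"
  have v_eq: "int v = (u + n * k) mod (n * \<bar>c\<bar>)" using n_pos c_nonzero by (simp add: v_def)
  have "coprime (int v) (n * \<bar>c\<bar>)"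
    unfolding v_eq using shift_coprime n_pos c_nonzero by (subst coprime_mod_left_iff) simp_all
  then have "coprime (int v) (n * c)" by simp
  then have "F (int v * g) = F g" by (rule coprime_multiplier)
  moreover have "[int v * g = u * g] (mod n)"
    unfolding v_eq by (intro cong_scalar_right) (simp add: cong_def mod_mod_cancel)
  ultimately show ?thesis
    using periodic_cong[OF periodic] by metis
qed

lemma unit_multiplier_affine:
  fixes Y :: "int \<Rightarrow> int"
  assumes n_pos: "n > 0" and periodic: "periodic n Y"
    and conv: "\<And>g. cyclic_conv n Y Y g = c * Y g + m"
    and c_nonzero: "c \<noteq> 0" and u_coprime: "coprime u n"
  shows "Y (u * g) = Y g"
proof -
  define s where "s = (\<Sum>h\<in>{0..<n}. Y h)"
  have "s\<^sup>2 = (\<Sum>g\<in>{0..<n}. c * Y g + m)"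
    using sum_cyclic_conv[OF n_pos periodic, of Y] by (simp add: s_def conv power2_eq_square)
  also have "\<dots> = c * s + n * m"
    using n_pos by (simp add: sum.distrib s_def flip: sum_distrib_left)
  finally have s_square: "s\<^sup>2 = c * s + n * m" .
  define F where "F g = n * Y g + - s" for g
  have "cyclic_conv n F F g = n * c * F g" for g
  proof -
    have "cyclic_conv n F F g = n\<^sup>2 * (c * Y g + m) - 2 * n * s * s + n * s\<^sup>2"
      unfolding F_def cyclic_conv_affine[OF n_pos periodic] by (simp add: conv s_def)
    also have "\<dots> = n * (n * (c * Y g + m) - s\<^sup>2)"
      by (simp add: power2_eq_square algebra_simps)
    also have "\<dots> = n * c * F g"
      unfolding s_square by (simp add: F_def algebra_simps)
    finally show ?thesis .
  qed
  moreover have "periodic n F" using periodic by (simp add: F_def periodic_def)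
  ultimately have "F (u * g) = F g"
    using n_pos c_nonzero
    by (intro unit_multiplier[OF n_pos _ _ _ u_coprime, where c = "n * c"]) auto
  then show ?thesis using n_pos by (simp add: F_def)
qed

subsection \<open>Even functions on cyclic groups of prime power order\<close>

lemma unit_invariant_eq_prime_power:
  fixes f :: "int \<Rightarrow> 'a" and p :: int
  assumes "prime p" and inv: "\<And>u g. \<not> p dvd u \<Longrightarrow> f (u * g) = f g" and "g \<noteq> 0"
  shows "f g = f (p ^ multiplicity p g)"
proof -
  obtain u where "g = p ^ multiplicity p g * u" "\<not> p dvd u"
    using multiplicity_decompose'[of g p] assms(1,3) not_prime_unit by blast
  then show ?thesis using inv by (metis mult.commute)
qed

lemma unit_invariant_add:
  fixes f :: "int \<Rightarrow> 'a" and p :: int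
  assumes "prime p" and inv: "\<And>u g. \<not> p dvd u \<Longrightarrow> f (u * g) = f g"
    and g_not_dvd: "\<not> p ^ v dvd g" and dvd_h: "p ^ v dvd h"
  shows "f (g + h) = f g"
proof (cases "h = 0")
  case False
  have unit: "\<not> is_unit p" using assms(1) not_prime_unit by blast
  have "g \<noteq> 0" using g_not_dvd by auto
  then have "multiplicity p g < v"
    using g_not_dvd power_dvd_iff_le_multiplicity[OF _ unit, of g v] by simp
  also have "v \<le> multiplicity p h"
    using dvd_h power_dvd_iff_le_multiplicity[OF False unit, of v] by simp
  finally have "multiplicity p (g + h) = multiplicity p g"
    using \<open>g \<noteq> 0\<close> False by (intro multiplicity_sum_lt) simp_all
  moreover have "g + h \<noteq> 0"
    using g_not_dvd dvd_h by (metis add_eq_0_iff dvd_minus_iff)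
  ultimately show ?thesis
    using unit_invariant_eq_prime_power[where f = f, OF assms(1) inv] \<open>g \<noteq> 0\<close> by metis
qed simp

lemma sum_of_bool_dvd:
  fixes N n g :: int
  assumes "N > 0" and "n > 0" and "N dvd n"
  shows "(\<Sum>h\<in>{0..<n}. of_bool (N dvd h + g)) = n div N"
proof -
  obtain r where n_eq: "n = N * r" using assms(3) by (elim dvdE)
  then have "r > 0" using assms by (simp add: zero_less_mult_iff)
  have multiples: "{h\<in>{0..<n}. N dvd h} = (*) N ` {0..<r}"
    using assms(1) by (auto simp: n_eq zero_le_mult_iff elim!: dvdE)
  have "periodic n (\<lambda>h. of_bool (N dvd h))"
    using assms(3) by (simp add: periodic_def dvd_mod_iff)
  from sum_periodic_shift[OF assms(2) this, of g]
  have "(\<Sum>h\<in>{0..<n}. of_bool (N dvd h + g)) = (\<Sum>h\<in>{0..<n}. of_bool (N dvd h) :: int)" .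
  also have "\<dots> = int (card ({0..<n} \<inter> {h. N dvd h}))"
    by simp
  also have "{0..<n} \<inter> {h. N dvd h} = (*) N ` {0..<r}"
    using multiples by blast
  also have "int (card \<dots>) = n div N"
    using assms(1) \<open>r > 0\<close> by (simp add: card_image inj_on_def n_eq)
  finally show ?thesis .
qed

locale prime_power_convolution =
  fixes p :: int and \<alpha> :: nat and Y :: "int \<Rightarrow> int" and c m :: int
  assumes prime_p: "prime p"
    and periodic: "periodic (p ^ \<alpha>) Y"
    and even: "Y (- g) = Y g"
    and zero: "Y 0 = 0"
    and nonzero: "\<exists>g. Y g \<noteq> 0"
    and conv: "cyclic_conv (p ^ \<alpha>) Y Y g = c * Y g + m"
begin

lemma p_gt_1: "p > 1"
  using prime_p by (rule prime_gt_1_int)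

lemma sum_translate_diff_square_eq:
  "(\<Sum>h\<in>{0..<p ^ \<alpha>}. (Y (h + g) - Y h)\<^sup>2) = - 2 * c * Y g"
  using sum_translate_diff_square[where f = Y, OF _ periodic even, of g] p_gt_1
  by (simp add: conv zero)

lemma periodic_if_sum_translate_diff_square_eq_0:
  assumes "(\<Sum>h\<in>{0..<p ^ \<alpha>}. (Y (h + g) - Y h)\<^sup>2) = 0"
  shows "periodic g Y"
  unfolding periodic_iff_shift
proof
  fix h
  have "\<forall>h\<in>{0..<p ^ \<alpha>}. (Y (h + g) - Y h)\<^sup>2 = 0"
    using assms by (subst (asm) sum_nonneg_eq_0_iff) auto
  then have "Y (h mod p ^ \<alpha> + g) = Y (h mod p ^ \<alpha>)"
    using p_gt_1 by simp
  moreover have "Y (h mod p ^ \<alpha> + g) = Y (h + g)" and "Y (h mod p ^ \<alpha>) = Y h"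
    by (auto intro!: periodic_cong[OF periodic] simp: cong_def mod_simps)
  ultimately show "Y (h + g) = Y h" by simp
qed

lemma c_nonzero: "c \<noteq> 0"
proof
  assume "c = 0"
  obtain g where "Y g \<noteq> 0" using nonzero by blast
  moreover have "periodic g Y"
    using sum_translate_diff_square_eq[of g] \<open>c = 0\<close>
    by (intro periodic_if_sum_translate_diff_square_eq_0) simp
  then have "Y g = Y 0" by (rule periodic_cong) (simp add: cong_def)
  ultimately show False using zero by simp
qed

lemma eq_zero_iff_periodic: "Y g = 0 \<longleftrightarrow> periodic g Y"
proof
  assume "Y g = 0"
  then show "periodic g Y"
    using sum_translate_diff_square_eq[of g]
    by (intro periodic_if_sum_translate_diff_square_eq_0) simp
next
  assume "periodic g Y"
  then have "Y g = Y 0" by (rule periodic_cong) (simp add: cong_def)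
  then show "Y g = 0" by (simp add: zero)
qed

lemma unit_invariant:
  assumes "\<not> p dvd u"
  shows "Y (u * g) = Y g"
proof -
  have "coprime u (p ^ \<alpha>)"
    using prime_imp_coprime[OF prime_p assms] by (simp add: coprime_commute)
  then show ?thesis
    using p_gt_1 by (intro unit_multiplier_affine[OF _ periodic conv c_nonzero]) simp_all
qed

lemma eq_prime_power: "g \<noteq> 0 \<Longrightarrow> Y g = Y (p ^ multiplicity p g)"
  by (rule unit_invariant_eq_prime_power[where f = Y, OF prime_p unit_invariant])

lemma eq_on_coset: "\<not> p ^ v dvd g \<Longrightarrow> p ^ v dvd h \<Longrightarrow> Y (g + h) = Y g"
  by (rule unit_invariant_add[where f = Y, OF prime_p unit_invariant])

definition level :: nat where
  "level = (LEAST v. Y (p ^ v) = 0)"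

lemma vanishes_at_order: "Y (p ^ \<alpha>) = 0"
  using periodic by (simp add: eq_zero_iff_periodic)

lemma level_le: "level \<le> \<alpha>"
  unfolding level_def by (rule Least_le) (rule vanishes_at_order)

lemma eq_zero_iff_dvd: "Y g = 0 \<longleftrightarrow> p ^ level dvd g"
proof
  assume "Y g = 0"
  show "p ^ level dvd g"
  proof (cases "g = 0")
    case False
    then have "level \<le> multiplicity p g"
      using eq_prime_power[OF False] \<open>Y g = 0\<close> unfolding level_def by (intro Least_le) simp
    then show ?thesis by (rule multiplicity_dvd')
  qed simp
next
  have "Y (p ^ level) = 0"
    unfolding level_def by (rule LeastI) (rule vanishes_at_order)
  then have "periodic (p ^ level) Y" by (simp add: eq_zero_iff_periodic)
  moreover assume "p ^ level dvd g"
  then have "[g = 0] (mod p ^ level)" by (simp add: cong_0_iff)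
  ultimately show "Y g = 0" using periodic_cong zero by metis
qed

lemma level_pos: "level > 0"
proof (rule ccontr)
  assume "\<not> level > 0"
  then show False using nonzero eq_zero_iff_dvd by simp
qed

definition last_value :: int where
  "last_value = Y (p ^ (level - 1))"

lemma eq_last_value:
  assumes "p ^ (level - 1) dvd g" and "\<not> p ^ level dvd g"
  shows "Y g = last_value"
proof -
  have "multiplicity p g = level - 1"
    using assms level_pos by (intro multiplicity_eqI) simp_all
  moreover have "g \<noteq> 0" using assms(2) by auto
  ultimately show ?thesis using eq_prime_power[of g] by (simp add: last_value_def)
qed

lemma last_value_nonzero: "last_value \<noteq> 0"
proof -
  have "\<not> p ^ level dvd p ^ (level - 1)"
    using level_pos p_gt_1 power_increasing_iff
    by (auto dest!: zdvd_imp_le simp: not_le)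
  then show ?thesis by (simp add: last_value_def eq_zero_iff_dvd)
qed

lemma power_pred_level_dvd: "p ^ (level - 1) dvd p ^ level"
  by (simp add: le_imp_power_dvd)

lemma translate_diff_square_eq:
  "(Y (h + p ^ (level - 1)) - Y h)\<^sup>2
    = last_value\<^sup>2 * of_bool (p ^ level dvd h)
      + last_value\<^sup>2 * of_bool (p ^ level dvd h + p ^ (level - 1))"
proof (cases "p ^ (level - 1) dvd h")
  case True
  then have sum_dvd: "p ^ (level - 1) dvd h + p ^ (level - 1)" by simp
  consider "p ^ level dvd h" "\<not> p ^ level dvd h + p ^ (level - 1)"
    | "\<not> p ^ level dvd h" "p ^ level dvd h + p ^ (level - 1)"
    | "\<not> p ^ level dvd h" "\<not> p ^ level dvd h + p ^ (level - 1)"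
    using last_value_nonzero eq_zero_iff_dvd[of "p ^ (level - 1)"]
    by (auto simp: last_value_def dvd_add_right_iff)
  then show ?thesis
  proof cases
    case 1
    then show ?thesis using eq_last_value[OF sum_dvd] eq_zero_iff_dvd[of h] by simp
  next
    case 2
    then show ?thesis
      using eq_last_value[OF True] eq_zero_iff_dvd[of "h + p ^ (level - 1)"] by simp
  next
    case 3
    then show ?thesis using eq_last_value[OF True] eq_last_value[OF sum_dvd] by simp
  qed
next
  case False
  then have "\<not> p ^ level dvd h" and "\<not> p ^ level dvd h + p ^ (level - 1)"
    using power_pred_level_dvd dvd_trans by (blast, metis dvd_add_left_iff dvd_refl dvd_trans)
  then show ?thesis using eq_on_coset[OF False, of "p ^ (level - 1)"] by simp
qed

lemma sum_of_bool_power_dvd: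
  "v \<le> \<alpha> \<Longrightarrow> (\<Sum>h\<in>{0..<p ^ \<alpha>}. of_bool (p ^ v dvd h + g)) = p ^ (\<alpha> - v)"
  using p_gt_1 sum_of_bool_dvd[of "p ^ v" "p ^ \<alpha>" g] by (simp add: le_imp_power_dvd power_diff)

lemma c_eq_minus_last_value_times: "c = - last_value * p ^ (\<alpha> - level)"
proof -
  have "- 2 * c * last_value
      = last_value\<^sup>2 * p ^ (\<alpha> - level) + last_value\<^sup>2 * p ^ (\<alpha> - level)"
    using sum_translate_diff_square_eq[of "p ^ (level - 1)"]
      sum_of_bool_power_dvd[OF level_le, of 0]
      sum_of_bool_power_dvd[OF level_le, of "p ^ (level - 1)"]
    unfolding translate_diff_square_eq sum.distrib sum_distrib_left[symmetric]
    by (simp add: last_value_def del: sum_of_bool_eq)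
  then have "last_value * (- c) = last_value * (last_value * p ^ (\<alpha> - level))"
    by (simp add: power2_eq_square algebra_simps)
  then have "- c = last_value * p ^ (\<alpha> - level)"
    using last_value_nonzero by (simp only: mult_cancel_left simp_thms)
  then show ?thesis by simp
qed

lemma translate_diff_square_ge:
  assumes "\<not> p ^ (level - 1) dvd g"
  defines "f \<equiv> \<lambda>h. of_bool (p ^ (level - 1) dvd h) * (Y g - Y h)\<^sup>2"
  shows "f h + f (h + g) \<le> (Y (h + g) - Y h)\<^sup>2"
proof -
  consider "p ^ (level - 1) dvd h" "\<not> p ^ (level - 1) dvd h + g"
    | "\<not> p ^ (level - 1) dvd h" "p ^ (level - 1) dvd h + g"
    | "\<not> p ^ (level - 1) dvd h" "\<not> p ^ (level - 1) dvd h + g"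
    using assms(1) by (metis dvd_add_right_iff)
  then show ?thesis
  proof cases
    case 1
    then have "Y (h + g) = Y g" using eq_on_coset[OF assms(1), of h] by (simp add: add.commute)
    then show ?thesis using 1 by (simp add: f_def)
  next
    case 2
    have "Y (- g + (h + g)) = Y (- g)"
      using assms(1) 2(2) by (intro eq_on_coset[of "level - 1"]) simp_all
    then have "Y h = Y g" by (simp add: even)
    then show ?thesis using 2 by (simp add: f_def power2_commute)
  qed (simp add: f_def)
qed

lemma deviation_bound:
  assumes "\<not> p ^ (level - 1) dvd g"
  shows "(p - 1) * (Y g - last_value)\<^sup>2 + (Y g)\<^sup>2 \<le> last_value * Y g"
proof -
  define r where "r = p ^ (\<alpha> - level)"
  define f where "f h = of_bool (p ^ (level - 1) dvd h) * (Y g - Y h)\<^sup>2" for h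
  define d where "d = (Y g - last_value)\<^sup>2"
  have "\<alpha> - (level - 1) = Suc (\<alpha> - level)"
    using level_pos level_le by simp
  then have counts: "(\<Sum>h\<in>{0..<p ^ \<alpha>}. of_bool (p ^ (level - 1) dvd h)) = p * r"
    "(\<Sum>h\<in>{0..<p ^ \<alpha>}. of_bool (p ^ level dvd h)) = r"
    using level_le sum_of_bool_power_dvd[of "level - 1" 0] sum_of_bool_power_dvd[of level 0]
    by (simp_all add: r_def del: sum_of_bool_eq)
  have "f h = d * of_bool (p ^ (level - 1) dvd h) + ((Y g)\<^sup>2 - d) * of_bool (p ^ level dvd h)" for h
    using eq_zero_iff_dvd[of h] eq_last_value[of h] power_pred_level_dvd
    by (auto simp: f_def d_def intro: dvd_trans)
  then have "(\<Sum>h\<in>{0..<p ^ \<alpha>}. f h) = d * (p * r) + ((Y g)\<^sup>2 - d) * r"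
    by (simp only: sum.distrib sum_distrib_left[symmetric] counts)
  then have sum_f: "(\<Sum>h\<in>{0..<p ^ \<alpha>}. f h) = r * ((p - 1) * d + (Y g)\<^sup>2)"
    by (simp add: algebra_simps)
  have "p ^ (level - 1) dvd p ^ \<alpha>" using level_le by (simp add: le_imp_power_dvd)
  then have "periodic (p ^ \<alpha>) f"
    using periodic by (simp add: f_def periodic_def dvd_mod_iff)
  from sum_periodic_shift[OF _ this, of g]
  have "(\<Sum>h\<in>{0..<p ^ \<alpha>}. f (h + g)) = (\<Sum>h\<in>{0..<p ^ \<alpha>}. f h)"
    using p_gt_1 by simp
  moreover have "(\<Sum>h\<in>{0..<p ^ \<alpha>}. f h) + (\<Sum>h\<in>{0..<p ^ \<alpha>}. f (h + g)) \<le> - 2 * c * Y g"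
    unfolding sum_translate_diff_square_eq[symmetric] sum.distrib[symmetric] f_def
    by (intro sum_mono translate_diff_square_ge assms)
  ultimately have "r * ((p - 1) * d + (Y g)\<^sup>2) \<le> r * (last_value * Y g)"
    by (simp add: sum_f c_eq_minus_last_value_times r_def mult_ac)
  then show ?thesis using p_gt_1 by (simp add: r_def d_def)
qed

lemma eq_last_value_off_level:
  assumes "odd p" and range: "\<And>g. Y g \<in> {0, 1, 2}"
  shows "Y g = (if p ^ level dvd g then 0 else last_value)"
proof (cases "p ^ (level - 1) dvd g")
  case True
  then show ?thesis using eq_last_value eq_zero_iff_dvd by auto
next
  case False
  then have not_dvd: "\<not> p ^ level dvd g"
    using power_pred_level_dvd dvd_trans by blast
  have "p \<ge> 3" using p_gt_1 assms(1) by (cases "p = 2") auto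
  then have "2 * (Y g - last_value)\<^sup>2 \<le> (p - 1) * (Y g - last_value)\<^sup>2"
    by (intro mult_right_mono) auto
  then have "2 * (Y g - last_value)\<^sup>2 + (Y g)\<^sup>2 \<le> last_value * Y g"
    using deviation_bound[OF False] by linarith
  moreover have "Y g \<in> {1, 2}" and "last_value \<in> {1, 2}"
    using range[of g] range[of "p ^ (level - 1)"] not_dvd last_value_nonzero
    by (auto simp: eq_zero_iff_dvd last_value_def)
  ultimately have "Y g = last_value" by auto
  then show ?thesis using not_dvd by simp
qed

end

subsection \<open>Directed strongly regular graphs\<close>

definition indexed_mat :: "'a list \<Rightarrow> ('a \<Rightarrow> 'a \<Rightarrow> 'b) \<Rightarrow> 'b mat" where
  "indexed_mat vs f = mat (length vs) (length vs) (\<lambda>(i, j). f (vs ! i) (vs ! j))"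

lemma indexed_mat_eq_iff:
  "indexed_mat vs f = indexed_mat vs g \<longleftrightarrow> (\<forall>u\<in>set vs. \<forall>v\<in>set vs. f u v = g u v)"
  by (simp add: indexed_mat_def mat_eq_iff all_set_conv_all_nth)

lemma indexed_mat_mult:
  assumes "distinct vs"
  shows "indexed_mat vs f * indexed_mat vs g = indexed_mat vs (\<lambda>u v. \<Sum>w\<in>set vs. f u w * g w v)"
proof -
  have "(\<Sum>l\<in>{0..<length vs}. h (vs ! l)) = (\<Sum>w\<in>set vs. h w)" for h :: "'a \<Rightarrow> 'b"
    using bij_betw_nth[OF assms, of "{0..<length vs}" "set vs"]
    by (intro sum.reindex_bij_betw) (simp add: atLeast0LessThan)
  from this[of "\<lambda>w. f (vs ! i) w * g w (vs ! j)" for i j] show ?thesis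
    by (simp add: indexed_mat_def mat_eq_iff scalar_prod_def)
qed

lemma indexed_mat_add:
  "indexed_mat vs f + indexed_mat vs g = indexed_mat vs (\<lambda>u v. f u v + g u v)"
  by (simp add: indexed_mat_def mat_eq_iff)

lemma indexed_mat_minus:
  "indexed_mat vs f - indexed_mat vs g = indexed_mat vs (\<lambda>u v. f u v - g u v)"
  by (simp add: indexed_mat_def mat_eq_iff)

lemma indexed_mat_smult: "a \<cdot>\<^sub>m indexed_mat vs f = indexed_mat vs (\<lambda>u v. a * f u v)"
  by (simp add: indexed_mat_def mat_eq_iff)

lemma one_mat_eq_indexed_mat:
  "distinct vs \<Longrightarrow> 1\<^sub>m (length vs) = indexed_mat vs (\<lambda>u v. of_bool (u = v))"
  by (simp add: indexed_mat_def mat_eq_iff nth_eq_iff_index_eq)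

lemma all_ones_mat_eq_indexed_mat: "all_ones_mat (length vs) = indexed_mat vs (\<lambda>u v. 1)"
  by (simp add: all_ones_mat_def indexed_mat_def mat_eq_iff)

lemma adjacency_mat_eq_indexed_mat:
  "adjacency_mat G vs = indexed_mat vs (\<lambda>u v. of_bool (u \<rightarrow>\<^bsub>G\<^esub> v))"
  by (simp add: adjacency_mat_def indexed_mat_def mat_eq_iff)

lemmas indexed_mat_simps = indexed_mat_add indexed_mat_minus indexed_mat_smult indexed_mat_eq_iff

lemma is_dsrg_iff_card:
  assumes "digraph G"
  shows "is_dsrg G n k \<mu> lam t \<longleftrightarrow> card (verts G) = n \<and>
    (\<forall>u\<in>verts G. card {v \<in> verts G. u \<rightarrow>\<^bsub>G\<^esub> v} = k) \<and>
    (\<forall>v\<in>verts G. card {u \<in> verts G. u \<rightarrow>\<^bsub>G\<^esub> v} = k) \<and>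
    (\<forall>u\<in>verts G. \<forall>v\<in>verts G. card {w \<in> verts G. u \<rightarrow>\<^bsub>G\<^esub> w \<and> w \<rightarrow>\<^bsub>G\<^esub> v} =
       (if u = v then t else if u \<rightarrow>\<^bsub>G\<^esub> v then lam else \<mu>))"
    (is "_ \<longleftrightarrow> _ \<and> ?counts")
proof -
  interpret digraph G by (rule assms)
  have matrix: "(let A = adjacency_mat G vs; J = all_ones_mat n; I = 1\<^sub>m n in
      A * J = int k \<cdot>\<^sub>m J \<and> J * A = int k \<cdot>\<^sub>m J \<and>
      A ^\<^sub>m 2 = int t \<cdot>\<^sub>m I + int lam \<cdot>\<^sub>m A + int \<mu> \<cdot>\<^sub>m (J - I - A)) \<longleftrightarrow> ?counts"
    if vs: "distinct vs" "set vs = verts G" and order: "card (verts G) = n" for vs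
  proof -
    have len: "n = length vs" using vs order distinct_card by fastforce
    have square: "indexed_mat vs f ^\<^sub>m 2 = indexed_mat vs f * indexed_mat vs f"
      for f :: "'a \<Rightarrow> 'a \<Rightarrow> int"
      by (simp add: numeral_2_eq_2 indexed_mat_def)
    have loop: "\<not> u \<rightarrow>\<^bsub>G\<^esub> u" for u using adj_not_same by blast
    have count: "(\<Sum>v\<in>verts G. of_bool (P v)) = int (card {v \<in> verts G. P v})" for P
      by (simp add: Collect_conj_eq Int_commute)
    have entry: "int t * of_bool (u = v) + int lam * of_bool (u \<rightarrow>\<^bsub>G\<^esub> v)
        + int \<mu> * (1 - of_bool (u = v) - of_bool (u \<rightarrow>\<^bsub>G\<^esub> v))
        = int (if u = v then t else if u \<rightarrow>\<^bsub>G\<^esub> v then lam else \<mu>)" for u v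
      using loop by auto
    show ?thesis
      unfolding Let_def len one_mat_eq_indexed_mat[OF vs(1)] all_ones_mat_eq_indexed_mat
        adjacency_mat_eq_indexed_mat square indexed_mat_mult[OF vs(1)] indexed_mat_simps vs(2) entry
      by (auto simp: count simp flip: of_bool_conj simp del: sum_of_bool_eq)
  qed
  obtain vs where "distinct vs" "set vs = verts G"
    using finite_distinct_list[OF finite_verts] by blast
  then show ?thesis
    unfolding is_dsrg_def using assms matrix by blast
qed

lemma cayley_digraph_dominates_iff:
  "g \<rightarrow>\<^bsub>cayley_digraph G S\<^esub> h \<longleftrightarrow>
    g \<in> carrier G \<and> h \<in> carrier G \<and> inv\<^bsub>G\<^esub> g \<otimes>\<^bsub>G\<^esub> h \<in> S"
  by (auto simp: cayley_digraph_def arcs_ends_conv image_iff)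

context group
begin

lemma digraph_cayley_digraph:
  assumes "finite (carrier G)" and "\<one> \<notin> S"
  shows "digraph (cayley_digraph G S)"
proof
  have "arcs (cayley_digraph G S) \<subseteq> carrier G \<times> carrier G"
    by (auto simp: cayley_digraph_def)
  then show "finite (arcs (cayley_digraph G S))"
    using assms(1) by (meson finite_SigmaI finite_subset)
qed (use assms in \<open>auto simp: cayley_digraph_def arc_to_ends_def\<close>)

lemma card_Collect_inv_mult:
  assumes "u \<in> carrier G"
  shows "card {h \<in> carrier G. P (inv u \<otimes> h)} = card {h \<in> carrier G. P h}"
  by (rule bij_betw_same_card[where f = "\<lambda>h. inv u \<otimes> h"],
      rule bij_betw_byWitness[where f' = "\<lambda>h. u \<otimes> h"])
     (use assms in \<open>auto simp: m_assoc[symmetric]\<close>)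

lemma card_Collect_inv: "card {h \<in> carrier G. P (inv h)} = card {h \<in> carrier G. P h}"
  by (rule bij_betw_same_card[where f = "\<lambda>h. inv h"],
      rule bij_betw_byWitness[where f' = "\<lambda>h. inv h"]) auto

lemma all_quotients_iff:
  "(\<forall>u\<in>carrier G. \<forall>v\<in>carrier G. P (inv u \<otimes> v)) \<longleftrightarrow> (\<forall>g\<in>carrier G. P g)"
  by (metis inv_closed inv_one l_one m_closed one_closed)

lemma cayley_digraph_out_degree:
  assumes "S \<subseteq> carrier G" and "u \<in> carrier G"
  shows "card {v \<in> carrier G. inv u \<otimes> v \<in> S} = card S"
proof -
  have "{h \<in> carrier G. h \<in> S} = S" using assms(1) by blast
  then show ?thesis using card_Collect_inv_mult[OF assms(2), of "\<lambda>h. h \<in> S"] by simp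
qed

lemma cayley_digraph_in_degree:
  assumes "S \<subseteq> carrier G" and "v \<in> carrier G"
  shows "card {u \<in> carrier G. inv u \<otimes> v \<in> S} = card S"
proof -
  have "{u \<in> carrier G. inv u \<otimes> v \<in> S} = {u \<in> carrier G. inv (inv v \<otimes> u) \<in> S}"
    using assms(2) by (auto simp: inv_mult_group)
  then have "card {u \<in> carrier G. inv u \<otimes> v \<in> S} = card {h \<in> carrier G. h \<in> S}"
    using card_Collect_inv_mult[OF assms(2), of "\<lambda>h. inv h \<in> S"]
      card_Collect_inv[of "\<lambda>h. h \<in> S"] by simp
  also have "{h \<in> carrier G. h \<in> S} = S" using assms(1) by blast
  finally show ?thesis .
qed

lemma cayley_digraph_card_2_paths:
  assumes S_subset: "S \<subseteq> carrier G" and u_carrier: "u \<in> carrier G" and v_carrier: "v \<in> carrier G"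
  shows "card {w \<in> carrier G. inv u \<otimes> w \<in> S \<and> inv w \<otimes> v \<in> S}
    = card {h \<in> S. inv h \<otimes> (inv u \<otimes> v) \<in> S}"
proof -
  have "inv (inv u \<otimes> w) \<otimes> (inv u \<otimes> v) = inv w \<otimes> v" if w_carrier: "w \<in> carrier G" for w
  proof -
    have "u \<otimes> (inv u \<otimes> v) = v" using u_carrier v_carrier by (simp flip: m_assoc)
    then show ?thesis using u_carrier v_carrier w_carrier by (simp add: inv_mult_group m_assoc)
  qed
  then have "{w \<in> carrier G. inv u \<otimes> w \<in> S \<and> inv w \<otimes> v \<in> S}
      = {w \<in> carrier G. inv u \<otimes> w \<in> S \<and> inv (inv u \<otimes> w) \<otimes> (inv u \<otimes> v) \<in> S}"
    by auto
  also have "card \<dots> = card {h \<in> carrier G. h \<in> S \<and> inv h \<otimes> (inv u \<otimes> v) \<in> S}"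
    by (rule card_Collect_inv_mult[OF u_carrier])
  also have "{h \<in> carrier G. h \<in> S \<and> inv h \<otimes> (inv u \<otimes> v) \<in> S}
      = {h \<in> S. inv h \<otimes> (inv u \<otimes> v) \<in> S}"
    using S_subset by blast
  finally show ?thesis .
qed

lemma is_dsrg_cayley_digraph_iff:
  assumes finite_carrier: "finite (carrier G)" and S_subset: "S \<subseteq> carrier G" and one_notin: "\<one> \<notin> S"
  shows "is_dsrg (cayley_digraph G S) n k \<mu> lam t \<longleftrightarrow> card (carrier G) = n \<and> card S = k \<and>
    (\<forall>g\<in>carrier G. card {h \<in> S. inv h \<otimes> g \<in> S} =
       (if g = \<one> then t else if g \<in> S then lam else \<mu>))"
proof -
  let ?G = "cayley_digraph G S"
  have verts: "verts ?G = carrier G"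
    by (simp add: cayley_digraph_def)
  have degrees: "card {v \<in> carrier G. u \<rightarrow>\<^bsub>?G\<^esub> v} = card S"
    "card {v \<in> carrier G. v \<rightarrow>\<^bsub>?G\<^esub> u} = card S"
    if "u \<in> carrier G" for u
    using that cayley_digraph_out_degree[OF S_subset that]
      cayley_digraph_in_degree[OF S_subset that]
    by (simp_all add: cayley_digraph_dominates_iff cong: conj_cong)
  have paths: "card {w \<in> carrier G. u \<rightarrow>\<^bsub>?G\<^esub> w \<and> w \<rightarrow>\<^bsub>?G\<^esub> v} = card {h \<in> S. inv h \<otimes> (inv u \<otimes> v) \<in> S}"
    if "u \<in> carrier G" "v \<in> carrier G" for u v
    using that cayley_digraph_card_2_paths[OF S_subset that]
    by (simp add: cayley_digraph_dominates_iff cong: conj_cong)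
  have target: "(if u = v then t else if u \<rightarrow>\<^bsub>?G\<^esub> v then lam else \<mu>)
      = (if inv u \<otimes> v = \<one> then t else if inv u \<otimes> v \<in> S then lam else \<mu>)"
    if "u \<in> carrier G" "v \<in> carrier G" for u v
  proof -
    have "u = v \<longleftrightarrow> inv u \<otimes> v = \<one>"
      using that by (metis inv_closed inv_equality inv_inv l_inv)
    then show ?thesis using that by (simp add: cayley_digraph_dominates_iff)
  qed
  have "carrier G \<noteq> {}" by blast
  then show ?thesis
    unfolding is_dsrg_iff_card[OF digraph_cayley_digraph[OF finite_carrier one_notin]] verts
      all_quotients_iff[symmetric, where P = "\<lambda>g. card {h \<in> S. inv h \<otimes> g \<in> S} =
       (if g = \<one> then t else if g \<in> S then lam else \<mu>)"]
    by (simp add: degrees paths target cong: ball_cong) blast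
qed

end

subsection \<open>Dihedrants\<close>

definition residue_indicator :: "int \<Rightarrow> int set \<Rightarrow> int \<Rightarrow> int" where
  "residue_indicator n X g = of_bool (g mod n \<in> X)"

lemma periodic_residue_indicator: "periodic n (residue_indicator n X)"
  by (simp add: periodic_def residue_indicator_def)

lemma inv_dihedral_group:
  assumes "n > 0" and "i \<in> {0..<int n}"
  shows "inv\<^bsub>dihedral_group n\<^esub> (i, s) = (if s then i else (- i) mod int n, s)"
proof -
  interpret group "dihedral_group n" by (rule group_dihedral_group[OF assms(1)])
  show ?thesis
    by (rule inv_equality) (use assms in \<open>auto simp: dihedral_group_carrier dihedral_group_mult
          dihedral_group_one mod_simps\<close>)
qed

lemma Dih_eq_cayley_digraph:
  assumes n_pos: "n > 0" and "X \<subseteq> {0..<int n}" and "Y \<subseteq> {0..<int n}"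
  shows "Dih n X Y = cayley_digraph (dihedral_group n) (X \<times> {False} \<union> Y \<times> {True})"
proof -
  have mod_n: "i mod int n = i" if "i \<in> X \<union> Y" for i using that assms by auto
  have "{dih_x n [^]\<^bsub>dihedral_group n\<^esub> i | i. i \<in> X} = X \<times> {False}"
    by (force simp: dih_x_int_pow[OF n_pos] mod_n)
  moreover have "{dih_x n [^]\<^bsub>dihedral_group n\<^esub> j \<otimes>\<^bsub>dihedral_group n\<^esub> dih_a n | j. j \<in> Y}
      = Y \<times> {True}"
    by (force simp: dih_x_int_pow[OF n_pos] dihedral_group_mult dih_a_def mod_n)
  ultimately show ?thesis by (simp add: Dih_def)
qed

lemma cyclic_conv_residue_indicator_symmetrization:
  assumes "X \<subseteq> {0..<n}"
  defines "x \<equiv> residue_indicator n X"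
  shows "cyclic_conv n x (symmetrization x) k
    = int (card {i \<in> X. (k - i) mod n \<in> X} + card {i \<in> X. (i - k) mod n \<in> X})"
proof -
  have fin: "finite X" using assms(1) finite_subset by blast
  have "cyclic_conv n x (symmetrization x) k
      = (\<Sum>i\<in>{0..<n}. of_bool (i \<in> X) * (x (k - i) + x (i - k)))"
    unfolding cyclic_conv_def
    by (intro sum.cong) (simp_all add: symmetrization_def x_def residue_indicator_def)
  also have "\<dots> = (\<Sum>i\<in>X. x (k - i) + x (i - k))"
    using assms(1) by (intro sum.mono_neutral_cong_right) auto
  finally show ?thesis
    using fin by (simp add: x_def residue_indicator_def sum.distrib Collect_conj_eq)
qed

lemma card_2_paths_dihedral_group:
  assumes "n > 0" and "X \<subseteq> {0..<int n}"
  defines "x \<equiv> residue_indicator (int n) X"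
  shows "int (card {h \<in> X \<times> UNIV. inv\<^bsub>dihedral_group n\<^esub> h \<otimes>\<^bsub>dihedral_group n\<^esub> (k, s) \<in> X \<times> UNIV})
    = cyclic_conv (int n) x (symmetrization x) k"
proof -
  define A B where "A = {i \<in> X. (k - i) mod int n \<in> X}" and "B = {i \<in> X. (i - k) mod int n \<in> X}"
  have "finite X" using assms(2) finite_subset by blast
  then have fin: "finite A" "finite B" by (simp_all add: A_def B_def)
  have "inv\<^bsub>dihedral_group n\<^esub> (i, b) \<otimes>\<^bsub>dihedral_group n\<^esub> (k, s)
      = ((if b then i - k else k - i) mod int n, b \<noteq> s)" if "i \<in> X" for i b
    using that assms(1,2) by (auto simp: inv_dihedral_group dihedral_group_mult mod_simps)
  then have "{h \<in> X \<times> UNIV. inv\<^bsub>dihedral_group n\<^esub> h \<otimes>\<^bsub>dihedral_group n\<^esub> (k, s) \<in> X \<times> UNIV}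
      = A \<times> {False} \<union> B \<times> {True}"
    by (auto simp: A_def B_def split: if_splits)
  also have "card \<dots> = card A + card B"
    using fin by (subst card_Un_disjoint) (auto simp: card_cartesian_product)
  finally show ?thesis
    unfolding x_def cyclic_conv_residue_indicator_symmetrization[OF assms(2)] A_def B_def by simp
qed

lemma is_dsrg_Dih_iff_residues:
  assumes n_pos: "n > 0" and X_residues: "X \<subseteq> {0..<int n}" "0 \<notin> X"
  defines "x \<equiv> residue_indicator (int n) X"
  shows "is_dsrg (Dih n X X) N k \<mu> lam t \<longleftrightarrow> 2 * n = N \<and> 2 * card X = k \<and> t = \<mu> \<and>
    (\<forall>i\<in>{0..<int n}. cyclic_conv (int n) x (symmetrization x) i = int (if i \<in> X then lam else \<mu>))"
proof -
  interpret group "dihedral_group n" by (rule group_dihedral_group[OF n_pos])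
  let ?S = "X \<times> (UNIV :: bool set)"
  define T where "T = cyclic_conv (int n) x (symmetrization x)"
  define paths where "paths g
      = card {h \<in> ?S. inv\<^bsub>dihedral_group n\<^esub> h \<otimes>\<^bsub>dihedral_group n\<^esub> g \<in> ?S}" for g
  have "int (paths (i, s)) = T i" for i s
    unfolding paths_def T_def x_def by (rule card_2_paths_dihedral_group[OF n_pos X_residues(1)])
  then have paths_eq_iff: "paths (i, s) = m \<longleftrightarrow> T i = int m" for i s m
    by (metis of_nat_eq_iff)
  have "X \<times> {False} \<union> X \<times> {True} = ?S" by auto
  then have "Dih n X X = cayley_digraph (dihedral_group n) ?S"
    by (simp add: Dih_eq_cayley_digraph[OF n_pos X_residues(1) X_residues(1)])
  moreover have "card (carrier (dihedral_group n)) = 2 * n" and "card ?S = 2 * card X"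
    by (simp_all add: dihedral_group_carrier card_cartesian_product)
  moreover have "finite (carrier (dihedral_group n))" and "?S \<subseteq> carrier (dihedral_group n)"
    and "\<one>\<^bsub>dihedral_group n\<^esub> \<notin> ?S"
    using X_residues by (auto simp: dihedral_group_carrier dihedral_group_one)
  ultimately have "is_dsrg (Dih n X X) N k \<mu> lam t \<longleftrightarrow> 2 * n = N \<and> 2 * card X = k \<and>
    (\<forall>g\<in>carrier (dihedral_group n). paths g =
       (if g = \<one>\<^bsub>dihedral_group n\<^esub> then t else if g \<in> ?S then lam else \<mu>))"
    (is "_ \<longleftrightarrow> _ \<and> _ \<and> ?paths")
    using is_dsrg_cayley_digraph_iff[of ?S N k \<mu> lam t] by (simp add: paths_def)
  also have "?paths \<longleftrightarrow> (\<forall>i\<in>{0..<int n}. \<forall>s.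
      T i = int (if i = 0 \<and> \<not> s then t else if i \<in> X then lam else \<mu>))" (is "_ \<longleftrightarrow> ?both")
    by (simp add: dihedral_group_carrier dihedral_group_one paths_eq_iff)
  also have "\<dots> \<longleftrightarrow> t = \<mu> \<and> (\<forall>i\<in>{0..<int n}. T i = int (if i \<in> X then lam else \<mu>))"
    (is "_ \<longleftrightarrow> ?reflections")
  proof
    assume both: ?both
    have "T 0 = int t" and "T 0 = int \<mu>"
      using both[rule_format, of 0 False] both[rule_format, of 0 True] n_pos X_residues(2)
      by simp_all
    then show ?reflections using both[rule_format, of _ True] by simp
  qed (use X_residues(2) in auto)
  finally show ?thesis unfolding T_def .
qed

lemma is_dsrg_Dih_iff:
  assumes n_pos: "n > 0" and X_residues: "X \<subseteq> {0..<int n}" "0 \<notin> X"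
  defines "x \<equiv> residue_indicator (int n) X"
  shows "is_dsrg (Dih n X X) N k \<mu> lam t \<longleftrightarrow> 2 * n = N \<and> 2 * card X = k \<and> t = \<mu> \<and>
    (\<forall>g. cyclic_conv (int n) x (symmetrization x) g = (int lam - int \<mu>) * x g + int \<mu>)"
proof -
  define T where "T = cyclic_conv (int n) x (symmetrization x)"
  have "(\<forall>i\<in>{0..<int n}. T i = int (if i \<in> X then lam else \<mu>))
      \<longleftrightarrow> (\<forall>i\<in>{0..<int n}. T i = (int lam - int \<mu>) * x i + int \<mu>)"
    by (intro ball_cong) (simp_all add: x_def residue_indicator_def)
  also have "\<dots> \<longleftrightarrow> (\<forall>i. T i = (int lam - int \<mu>) * x i + int \<mu>)"
  proof (rule periodic_eq_iff)
    have "periodic (int n) x" unfolding x_def by (rule periodic_residue_indicator)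
    then show "periodic (int n) (\<lambda>i. (int lam - int \<mu>) * x i + int \<mu>)"
      by (simp add: periodic_def)
    show "periodic (int n) T"
      unfolding T_def by (intro periodic_cyclic_conv periodic_symmetrization) fact
  qed (use n_pos in simp)
  finally show ?thesis
    using is_dsrg_Dih_iff_residues[OF n_pos X_residues] by (simp add: T_def x_def)
qed

lemma genuine_dsrg_Dih_iff:
  assumes n_pos: "n > 0" and X_residues: "X \<subseteq> {0..<int n}" "0 \<notin> X"
  defines "x \<equiv> residue_indicator (int n) X"
  shows "genuine_dsrg (Dih n X X) \<longleftrightarrow> (\<exists>c \<mu>. 0 < \<mu> \<and> \<mu> < 2 * int (card X) \<and> 0 \<le> c + \<mu> \<and>
    (\<forall>g. cyclic_conv (int n) x (symmetrization x) g = c * x g + \<mu>))"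
    (is "_ \<longleftrightarrow> ?R")
proof
  assume "genuine_dsrg (Dih n X X)"
  then obtain \<mu> lam :: nat where "0 < \<mu>" "\<mu> < 2 * card X"
    and "\<forall>g. cyclic_conv (int n) x (symmetrization x) g = (int lam - int \<mu>) * x g + int \<mu>"
    unfolding genuine_dsrg_def is_dsrg_Dih_iff[OF n_pos X_residues] x_def by blast
  then show ?R
    by (intro exI[of _ "int lam - int \<mu>"] exI[of _ "int \<mu>"]) simp
next
  assume ?R
  then obtain c \<mu> where \<mu>: "0 < \<mu>" "\<mu> < 2 * int (card X)" "0 \<le> c + \<mu>"
    and "\<forall>g. cyclic_conv (int n) x (symmetrization x) g = c * x g + \<mu>" by blast
  then have "is_dsrg (Dih n X X) (2 * n) (2 * card X) (nat \<mu>) (nat (c + \<mu>)) (nat \<mu>)"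
    unfolding is_dsrg_Dih_iff[OF n_pos X_residues] x_def by simp
  moreover have "0 < nat \<mu>" and "nat \<mu> < 2 * card X" using \<mu> by simp_all
  ultimately show "genuine_dsrg (Dih n X X)"
    unfolding genuine_dsrg_def by blast
qed

subsection \<open>Skew residue sets\<close>

definition skew_modulo :: "int \<Rightarrow> (int \<Rightarrow> int) \<Rightarrow> bool" where
  "skew_modulo N f \<longleftrightarrow> periodic N f \<and> (\<forall>g. symmetrization f g = of_bool (\<not> N dvd g))"

lemma cyclic_conv_of_bool_not_dvd:
  "cyclic_conv n f (\<lambda>i. of_bool (\<not> N dvd i)) g
    = (\<Sum>h\<in>{0..<n}. f h) - cyclic_conv n f (\<lambda>i. of_bool (N dvd i)) g"
  unfolding cyclic_conv_def sum_subtractf[symmetric] by (intro sum.cong) simp_all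

lemma cyclic_conv_of_bool_dvd:
  fixes f :: "int \<Rightarrow> int"
  assumes "N > 0" and "n > 0" and "N dvd n" and "periodic N f"
  shows "cyclic_conv n f (\<lambda>i. of_bool (N dvd i)) g = n div N * f g"
proof -
  have "f h * of_bool (N dvd g - h) = f g * of_bool (N dvd h + - g)" for h
  proof -
    have "N dvd g - h \<longleftrightarrow> N dvd h + - g"
      using dvd_minus_iff[of N "g - h"] by simp
    moreover have "f h = f g" if "N dvd h + - g"
      using that periodic_cong[OF assms(4), of h g] by (simp add: cong_iff_dvd_diff)
    ultimately show ?thesis by auto
  qed
  then have "cyclic_conv n f (\<lambda>i. of_bool (N dvd i)) g
      = f g * (\<Sum>h\<in>{0..<n}. of_bool (N dvd h + - g))"
    by (simp only: cyclic_conv_def sum_distrib_left)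
  then show ?thesis
    unfolding sum_of_bool_dvd[OF assms(1-3)] by (simp add: mult.commute)
qed

lemma periodic_if_cyclic_conv_of_bool_not_dvd:
  fixes f :: "int \<Rightarrow> int"
  assumes "\<And>g. cyclic_conv n f (\<lambda>i. of_bool (\<not> N dvd i)) g = c * f g + m" and "c \<noteq> 0"
  shows "periodic N f"
proof (rule periodicI)
  fix i j assume "[i = j] (mod N)"
  then have "N dvd i - h \<longleftrightarrow> N dvd j - h" for h
    by (metis cong_diff cong_dvd_iff cong_refl)
  then have "c * f i + m = c * f j + m"
    unfolding assms(1)[symmetric] cyclic_conv_def by simp
  then show "f i = f j" using assms(2) by simp
qed

lemma sum_residue_indicator:
  assumes "X \<subseteq> {0..<n}"
  shows "(\<Sum>h\<in>{0..<n}. residue_indicator n X h) = int (card X)"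
proof -
  have "(\<Sum>h\<in>{0..<n}. residue_indicator n X h) = (\<Sum>h\<in>{0..<n}. of_bool (h \<in> X))"
    by (intro sum.cong) (simp_all add: residue_indicator_def)
  then show ?thesis using assms by (simp add: Int_absorb1)
qed

lemma genuine_dsrg_Dih_if_skew_modulo:
  assumes n_pos: "n > 0" and X_residues: "X \<subseteq> {0..<int n}" "0 \<notin> X"
    and N_gt_2: "N > 2" and N_dvd: "N dvd int n"
    and skew: "skew_modulo N (residue_indicator (int n) X)"
  shows "genuine_dsrg (Dih n X X)"
proof -
  define x where "x = residue_indicator (int n) X"
  define r where "r = int n div N"
  have n_eq: "int n = N * r" using N_dvd by (simp add: r_def)
  then have "r > 0" using n_pos N_gt_2
    by (metis of_nat_0_less_iff zero_less_mult_pos less_trans zero_less_numeral)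
  have periodic: "periodic N x"
    and symmetrization_x: "symmetrization x = (\<lambda>g. of_bool (\<not> N dvd g))"
    using skew by (auto simp: skew_modulo_def x_def)
  have conv: "cyclic_conv (int n) x (symmetrization x) g = - r * x g + int (card X)" for g
    unfolding symmetrization_x cyclic_conv_of_bool_not_dvd
    using cyclic_conv_of_bool_dvd[of N "int n" x g] sum_residue_indicator[OF X_residues(1)] periodic
      n_pos N_gt_2 N_dvd
    by (simp add: x_def r_def)
  have "2 * int (card X) = (\<Sum>h\<in>{0..<int n}. of_bool (\<not> N dvd h))"
    using sum_symmetrization[of "int n" x] n_pos sum_residue_indicator[OF X_residues(1)]
    unfolding symmetrization_x by (simp add: x_def periodic_residue_indicator del: sum_of_bool_eq)
  also have "\<dots> = (\<Sum>h\<in>{0..<int n}. 1 - of_bool (N dvd h + 0))"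
    by (intro sum.cong) simp_all
  also have "\<dots> = int n - r"
    unfolding sum_subtractf using sum_of_bool_dvd[of N "int n" 0] n_pos N_gt_2 N_dvd
    by (simp add: r_def del: sum_of_bool_eq)
  finally have "2 * int (card X) = (N - 1) * r" by (simp add: n_eq left_diff_distrib)
  moreover have "2 * r \<le> (N - 1) * r" using N_gt_2 \<open>r > 0\<close> by (intro mult_right_mono) auto
  ultimately have "r \<le> int (card X)" by linarith
  then have "0 < int (card X)" "int (card X) < 2 * int (card X)" "0 \<le> - r + int (card X)"
    using \<open>r > 0\<close> by linarith+
  then show ?thesis
    unfolding genuine_dsrg_Dih_iff[OF n_pos X_residues] x_def[symmetric] using conv by blast
qed

lemma symmetrization_two_valued:
  fixes p \<alpha> :: nat and x :: "int \<Rightarrow> int"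
  assumes odd_prime: "prime p" "odd p" and periodic: "periodic (int (p ^ \<alpha>)) x"
    and range: "\<And>g. x g \<in> {0, 1}" and zero: "x 0 = 0" and nonzero: "x g0 \<noteq> 0"
    and conv: "\<And>g. cyclic_conv (int (p ^ \<alpha>)) x (symmetrization x) g = c * x g + m"
  obtains \<gamma> y where "1 \<le> \<gamma>" "\<gamma> \<le> \<alpha>" "y \<in> {1, 2}" "c = - y * int (p ^ (\<alpha> - \<gamma>))"
    "\<And>g. symmetrization x g = (if int (p ^ \<gamma>) dvd g then 0 else y)"
proof -
  define Y where "Y = symmetrization x"
  have Y_eq: "Y g = x g + x (- g)" for g by (simp add: Y_def symmetrization_def)
  have Y_range: "Y g \<in> {0, 1, 2}" for g
    using range[of g] range[of "- g"] by (auto simp: Y_eq)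
  interpret prime_power_convolution "int p" \<alpha> Y c "2 * m"
  proof
    have "int (p ^ \<alpha>) > 0" using prime_gt_0_nat[OF odd_prime(1)] by simp
    then show "cyclic_conv (int p ^ \<alpha>) Y Y g = c * Y g + 2 * m" for g
      using cyclic_conv_symmetrization[OF _ periodic conv] by (simp add: Y_def)
    show "periodic (int p ^ \<alpha>) Y"
      using periodic_symmetrization[OF periodic] by (simp add: Y_def)
    have "Y g0 \<noteq> 0" using nonzero range[of g0] range[of "- g0"] by (auto simp: Y_eq)
    then show "\<exists>g. Y g \<noteq> 0" ..
  qed (use odd_prime(1) zero in \<open>simp_all add: Y_eq\<close>)
  have "last_value \<in> {1, 2}"
    using last_value_nonzero Y_range[of "int p ^ (level - 1)"] by (simp add: last_value_def)
  moreover have "symmetrization x g = (if int (p ^ level) dvd g then 0 else last_value)" for g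
    using eq_last_value_off_level[OF _ Y_range, of g] odd_prime(2) by (simp add: Y_def)
  ultimately show thesis
    using that[of level last_value] level_pos level_le c_eq_minus_last_value_times by simp
qed

lemma cyclic_conv_even_residue_indicator:
  assumes "X \<subseteq> {0..<n}" and "\<And>g. residue_indicator n X (- g) = residue_indicator n X g"
  shows "cyclic_conv n (residue_indicator n X) (symmetrization (residue_indicator n X)) 0
    = 2 * int (card X)"
proof -
  have "residue_indicator n X h * symmetrization (residue_indicator n X) (0 - h)
      = 2 * residue_indicator n X h" for h
    using assms(2)[of h] by (simp add: symmetrization_def residue_indicator_def)
  then show ?thesis
    using sum_residue_indicator[OF assms(1)]
    by (simp only: cyclic_conv_def sum_distrib_left[symmetric])
qed

lemma skew_modulo_if_genuine_dsrg_Dih: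
  fixes p \<alpha> :: nat
  assumes odd_prime: "prime p" "odd p" and X_residues: "X \<subseteq> {0..<int (p ^ \<alpha>)}" "0 \<notin> X"
    and dsrg: "genuine_dsrg (Dih (p ^ \<alpha>) X X)"
  obtains \<gamma> where "1 \<le> \<gamma>" "\<gamma> \<le> \<alpha>"
    "skew_modulo (int (p ^ \<gamma>)) (residue_indicator (int (p ^ \<alpha>)) X)"
proof -
  define n where "n = p ^ \<alpha>"
  define x where "x = residue_indicator (int n) X"
  have n_pos: "n > 0" using prime_gt_0_nat[OF odd_prime(1)] by (simp add: n_def)
  have X_subset_n: "X \<subseteq> {0..<int n}" using X_residues(1) by (simp add: n_def)
  obtain c \<mu> where \<mu>: "0 < \<mu>" "\<mu> < 2 * int (card X)"
    and conv: "\<And>g. cyclic_conv (int n) x (symmetrization x) g = c * x g + \<mu>"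
    using dsrg genuine_dsrg_Dih_iff[OF n_pos X_subset_n X_residues(2)]
    unfolding x_def n_def by blast
  have x_range: "x g \<in> {0, 1}" for g by (simp add: x_def residue_indicator_def)
  have x_0: "x 0 = 0" using X_residues(2) by (simp add: x_def residue_indicator_def)
  have "X \<noteq> {}" using \<mu> by auto
  then obtain g0 where "g0 \<in> X" by blast
  then have "x g0 \<noteq> 0" using X_subset_n by (auto simp: x_def residue_indicator_def)
  moreover have "periodic (int n) x" unfolding x_def by (rule periodic_residue_indicator)
  ultimately obtain \<gamma> y where \<gamma>: "1 \<le> \<gamma>" "\<gamma> \<le> \<alpha>" and y_range: "y \<in> {1, 2}"
    and c_eq: "c = - y * int (p ^ (\<alpha> - \<gamma>))"
    and sym: "\<And>g. symmetrization x g = (if int (p ^ \<gamma>) dvd g then 0 else y)"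
    using symmetrization_two_valued[OF odd_prime _ x_range x_0 _ conv[unfolded n_def]]
    unfolding n_def by blast
  have "y \<noteq> 2"
  proof
    assume "y = 2"
    then have "x (- g) = x g" for g
      using sym[of g] x_range[of g] x_range[of "- g"]
      by (auto simp: symmetrization_def split: if_splits)
    then show False
      using cyclic_conv_even_residue_indicator[OF X_subset_n] conv[of 0] x_0 \<mu> by (simp add: x_def)
  qed
  then have y_eq: "y = 1" using y_range by simp
  have skew: "symmetrization x = (\<lambda>g. of_bool (\<not> int (p ^ \<gamma>) dvd g))"
    unfolding fun_eq_iff sym y_eq by simp
  have "c \<noteq> 0" using c_eq y_eq prime_gt_0_nat[OF odd_prime(1)] by simp
  then have "periodic (int (p ^ \<gamma>)) x"
    using conv unfolding skew by (intro periodic_if_cyclic_conv_of_bool_not_dvd)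
  then have "skew_modulo (int (p ^ \<gamma>)) x" by (simp add: skew_modulo_def skew)
  then show thesis using that \<gamma> by (simp add: x_def n_def)
qed

lemma in_neg_set_iff:
  assumes "m > 1" and "H \<subseteq> {0..<int m}"
  shows "g \<in> neg_set m H \<longleftrightarrow> g \<in> {0..<int m} \<and> (- g) mod int m \<in> H"
proof -
  interpret residues "int m" "residue_ring (int m)"
    using assms(1) by unfold_locales auto
  have "neg_set m H = (\<lambda>h. (- h) mod int m) ` H"
    by (auto simp: neg_set_def res_neg_eq)
  also have "g \<in> \<dots> \<longleftrightarrow> g \<in> {0..<int m} \<and> (- g) mod int m \<in> H"
  proof
    assume "g \<in> (\<lambda>h. (- h) mod int m) ` H"
    then obtain h where "h \<in> H" "g = (- h) mod int m" by blast
    then show "g \<in> {0..<int m} \<and> (- g) mod int m \<in> H"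
      using assms by (auto simp: mod_minus_eq)
  next
    assume g_residue: "g \<in> {0..<int m} \<and> (- g) mod int m \<in> H"
    then have "g = (- ((- g) mod int m)) mod int m" by (simp add: mod_minus_eq)
    then show "g \<in> (\<lambda>h. (- h) mod int m) ` H" using g_residue by blast
  qed
  finally show ?thesis .
qed

lemma neg_set_partition_iff:
  assumes "m > 1" and H_subset: "H \<subseteq> {0..<int m}"
  shows "H \<union> neg_set m H = {0..<int m} - {0} \<and> H \<inter> neg_set m H = {} \<longleftrightarrow>
    skew_modulo (int m) (residue_indicator (int m) H)"
proof -
  define x where "x = residue_indicator (int m) H"
  have periodic: "periodic (int m) x" unfolding x_def by (rule periodic_residue_indicator)
  have "H \<union> neg_set m H = {0..<int m} - {0} \<and> H \<inter> neg_set m H = {} \<longleftrightarrow>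
    (\<forall>g\<in>{0..<int m}. (g \<in> H \<or> (- g) mod int m \<in> H \<longleftrightarrow> g \<noteq> 0) \<and> \<not> (g \<in> H \<and> (- g) mod int m \<in> H))"
    using H_subset unfolding set_eq_iff subset_iff Un_iff Int_iff Diff_iff in_neg_set_iff[OF assms]
    by (simp only: insert_iff empty_iff) blast
  also have "\<dots> \<longleftrightarrow> (\<forall>g\<in>{0..<int m}. symmetrization x g = of_bool (\<not> int m dvd g))"
  proof (intro ball_cong refl)
    fix g assume "g \<in> {0..<int m}"
    then have "int m dvd g \<longleftrightarrow> g = 0" and "g mod int m = g"
      by (auto dest: zdvd_imp_le)
    then show "(g \<in> H \<or> (- g) mod int m \<in> H \<longleftrightarrow> g \<noteq> 0) \<and> \<not> (g \<in> H \<and> (- g) mod int m \<in> H)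
        \<longleftrightarrow> symmetrization x g = of_bool (\<not> int m dvd g)"
      by (auto simp: symmetrization_def x_def residue_indicator_def)
  qed
  also have "\<dots> \<longleftrightarrow> (\<forall>g. symmetrization x g = of_bool (\<not> int m dvd g))"
    using assms(1) periodic_symmetrization[OF periodic]
    by (intro periodic_eq_iff) (simp_all add: periodic_def dvd_mod_iff)
  finally show ?thesis using periodic by (simp add: skew_modulo_def x_def)
qed

lemma eq_psi_preimage_iff:
  assumes "p > 0" and "\<gamma> \<le> \<alpha>" and X_subset: "X \<subseteq> {0..<int (p ^ \<alpha>)}"
  shows "X = psi_preimage p \<alpha> \<gamma> H \<longleftrightarrow>
    residue_indicator (int (p ^ \<alpha>)) X = residue_indicator (int (p ^ \<gamma>)) H"
proof -
  define n N where "n = int (p ^ \<alpha>)" and "N = int (p ^ \<gamma>)"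
  have n_pos: "n > 0" using assms(1) by (simp add: n_def)
  have mod_mod: "g mod n mod N = g mod N" for g
    using assms(2) by (simp add: n_def N_def mod_mod_cancel le_imp_power_dvd)
  have "X = psi_preimage p \<alpha> \<gamma> H \<longleftrightarrow> (\<forall>g\<in>{0..<n}. g \<in> X \<longleftrightarrow> g mod N \<in> H)"
    using X_subset by (auto simp: psi_preimage_def psi_def residue_ring_def n_def N_def)
  also have "\<dots> \<longleftrightarrow> (\<forall>g. g mod n \<in> X \<longleftrightarrow> g mod N \<in> H)"
  proof
    assume "\<forall>g\<in>{0..<n}. g \<in> X \<longleftrightarrow> g mod N \<in> H"
    then show "\<forall>g. g mod n \<in> X \<longleftrightarrow> g mod N \<in> H"
      using n_pos by (metis atLeastLessThan_iff mod_mod pos_mod_bound pos_mod_sign)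
  next
    assume "\<forall>g. g mod n \<in> X \<longleftrightarrow> g mod N \<in> H"
    then show "\<forall>g\<in>{0..<n}. g \<in> X \<longleftrightarrow> g mod N \<in> H"
      by (metis atLeastLessThan_iff mod_pos_pos_trivial)
  qed
  finally show ?thesis
    unfolding fun_eq_iff residue_indicator_def of_bool_eq_iff n_def N_def .
qed

lemma residue_indicator_restrict:
  assumes "0 < N" and "N \<le> n" and "periodic N (residue_indicator n X)"
  shows "residue_indicator N (X \<inter> {0..<N}) = residue_indicator n X"
proof
  fix g
  have "g mod N mod n = g mod N"
    using assms(1,2) by (intro mod_pos_pos_trivial) (auto intro: less_le_trans[OF pos_mod_bound])
  then have "residue_indicator N (X \<inter> {0..<N}) g = residue_indicator n X (g mod N)"
    using assms(1) by (simp add: residue_indicator_def)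
  then show "residue_indicator N (X \<inter> {0..<N}) g = residue_indicator n X g"
    using assms(3) by (simp add: periodic_def)
qed

lemma skew_modulo_iff_psi_preimage:
  fixes p \<alpha> \<gamma> :: nat
  assumes "p > 1" and "1 \<le> \<gamma>" and "\<gamma> \<le> \<alpha>" and X_subset: "X \<subseteq> {0..<int (p ^ \<alpha>)}"
  shows "skew_modulo (int (p ^ \<gamma>)) (residue_indicator (int (p ^ \<alpha>)) X) \<longleftrightarrow>
    (\<exists>H \<subseteq> {0..<int (p ^ \<gamma>)}. X = psi_preimage p \<alpha> \<gamma> H \<and>
       H \<union> neg_set (p ^ \<gamma>) H = {0..<int (p ^ \<gamma>)} - {0} \<and> H \<inter> neg_set (p ^ \<gamma>) H = {})"
    (is "?skew \<longleftrightarrow> ?preimage")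
proof -
  define N where "N = p ^ \<gamma>"
  have N_gt_1: "N > 1" unfolding N_def using assms(1,2) by (intro one_less_power) simp_all
  have "?preimage \<longleftrightarrow> (\<exists>H \<subseteq> {0..<int N}.
      residue_indicator (int (p ^ \<alpha>)) X = residue_indicator (int N) H \<and>
      skew_modulo (int N) (residue_indicator (int N) H))"
    unfolding N_def[symmetric]
    using neg_set_partition_iff[OF N_gt_1] eq_psi_preimage_iff[OF _ assms(3) X_subset] assms(1)
    by (simp add: N_def cong: conj_cong)
  also have "\<dots> \<longleftrightarrow> ?skew"
  proof
    assume skew: ?skew
    have "int N \<le> int (p ^ \<alpha>)"
      using assms(1,3) by (simp add: N_def power_increasing)
    moreover have "periodic (int N) (residue_indicator (int (p ^ \<alpha>)) X)"
      using skew by (simp add: skew_modulo_def N_def)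
    ultimately have
      "residue_indicator (int N) (X \<inter> {0..<int N}) = residue_indicator (int (p ^ \<alpha>)) X"
      using N_gt_1 by (intro residue_indicator_restrict) simp_all
    then show "\<exists>H \<subseteq> {0..<int N}. residue_indicator (int (p ^ \<alpha>)) X = residue_indicator (int N) H \<and>
        skew_modulo (int N) (residue_indicator (int N) H)"
      using skew by (intro exI[of _ "X \<inter> {0..<int N}"]) (simp add: N_def)
  qed (auto simp: N_def)
  finally show ?thesis by simp
qed

lemma genuine_dsrg_Dih_prime_power_iff:
  fixes p \<alpha> :: nat
  assumes odd_prime: "prime p" "odd p" and X_residues: "X \<subseteq> {0..<int (p ^ \<alpha>)}" "0 \<notin> X"
  shows "genuine_dsrg (Dih (p ^ \<alpha>) X X) \<longleftrightarrow> (\<exists>\<gamma>. 1 \<le> \<gamma> \<and> \<gamma> \<le> \<alpha> \<and>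
      skew_modulo (int (p ^ \<gamma>)) (residue_indicator (int (p ^ \<alpha>)) X))"
proof
  assume "genuine_dsrg (Dih (p ^ \<alpha>) X X)"
  then show "\<exists>\<gamma>. 1 \<le> \<gamma> \<and> \<gamma> \<le> \<alpha> \<and>
      skew_modulo (int (p ^ \<gamma>)) (residue_indicator (int (p ^ \<alpha>)) X)"
    using skew_modulo_if_genuine_dsrg_Dih[OF odd_prime X_residues] by metis
next
  assume "\<exists>\<gamma>. 1 \<le> \<gamma> \<and> \<gamma> \<le> \<alpha> \<and>
      skew_modulo (int (p ^ \<gamma>)) (residue_indicator (int (p ^ \<alpha>)) X)"
  then obtain \<gamma> where \<gamma>: "1 \<le> \<gamma>" "\<gamma> \<le> \<alpha>"
    and skew: "skew_modulo (int (p ^ \<gamma>)) (residue_indicator (int (p ^ \<alpha>)) X)" by blast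
  have "p > 2" using odd_prime prime_gt_1_nat[of p] by (cases "p = 2") auto
  also have "p \<le> p ^ \<gamma>" using \<gamma>(1) by (intro self_le_power) (use \<open>p > 2\<close> in simp_all)
  finally have "int (p ^ \<gamma>) > 2" by linarith
  moreover have "int (p ^ \<gamma>) dvd int (p ^ \<alpha>)" using \<gamma>(2) by (simp add: le_imp_power_dvd)
  ultimately show "genuine_dsrg (Dih (p ^ \<alpha>) X X)"
    using genuine_dsrg_Dih_if_skew_modulo[OF _ X_residues _ _ skew] \<open>p > 2\<close> by simp
qed

theorem theorem6p1:
  fixes p \<alpha> :: nat and X :: "int set"
  assumes "prime p" and "odd p" and "\<alpha> \<ge> 1"
    and "X \<subseteq> carrier (residue_ring (int (p ^ \<alpha>))) - {0}"
  shows "genuine_dsrg (Dih (p ^ \<alpha>) X X) \<longleftrightarrow>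
    (\<exists>\<gamma> H. 1 \<le> \<gamma> \<and> \<gamma> \<le> \<alpha> \<and> H \<subseteq> carrier (residue_ring (int (p ^ \<gamma>))) \<and>
       X = psi_preimage p \<alpha> \<gamma> H \<and>
       H \<union> neg_set (p ^ \<gamma>) H = carrier (residue_ring (int (p ^ \<gamma>))) - {0} \<and>
       H \<inter> neg_set (p ^ \<gamma>) H = {})"
proof -
  have carrier: "carrier (residue_ring (int m)) = {0..<int m}" for m
    by (auto simp: residue_ring_def)
  have X_residues: "X \<subseteq> {0..<int (p ^ \<alpha>)}" "0 \<notin> X"
    using assms(4) unfolding carrier by auto
  have "p > 1" using assms(1) by (rule prime_gt_1_nat)
  have "genuine_dsrg (Dih (p ^ \<alpha>) X X) \<longleftrightarrow> (\<exists>\<gamma>. 1 \<le> \<gamma> \<and> \<gamma> \<le> \<alpha> \<and>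
      skew_modulo (int (p ^ \<gamma>)) (residue_indicator (int (p ^ \<alpha>)) X))"
    by (rule genuine_dsrg_Dih_prime_power_iff[OF assms(1,2) X_residues])
  also have "\<dots> \<longleftrightarrow> (\<exists>\<gamma>. 1 \<le> \<gamma> \<and> \<gamma> \<le> \<alpha> \<and>
      (\<exists>H \<subseteq> {0..<int (p ^ \<gamma>)}. X = psi_preimage p \<alpha> \<gamma> H \<and>
       H \<union> neg_set (p ^ \<gamma>) H = {0..<int (p ^ \<gamma>)} - {0} \<and> H \<inter> neg_set (p ^ \<gamma>) H = {}))"
    using skew_modulo_iff_psi_preimage[OF \<open>p > 1\<close> _ _ X_residues(1)]
    by (intro ex_cong1 conj_cong refl)
  finally show ?thesis unfolding carrier by blast
qed

end
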